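(* Let $H$ be a finite index normal subgroup of a finitely generated group $G$, let $T\subset H$, and let $\mathcal{Q}$ be a finite collection of infinite subgroups of $H$ such that $\mathcal{Q}\hookrightarrow_h(H,T)$. Suppose: (1) The set $T$ is invariant under conjugation by $G$. (2) The collection $\{hQh^{-1} : h\in H \text{ and } Q\in\mathcal{Q}\}$ is invariant under conjugation by $G$. If $\mathcal{Q}^*$ is a refinement of $\mathcal{Q}$ in $G$, then $\mathcal{Q}^*\hookrightarrow_h G$.
   Context: The commensurator of $P\le G$ is $\mathrm{Comm}_G(P)=\{g\in G : P\cap gPg^{-1}$ has finite index in both $P$ and $gPg^{-1}\}$. A refinement $\mathcal{P}^*$ of a collection $\mathcal{P}$ of subgroups of $G$ is a set of representatives of the conjugacy classes (in $G$) of the collection of subgroups $\{\mathrm{Comm}_G(gPg^{-1}) : P\in\mathcal{P},\ g\in G\}$. For a collection $\mathcal{P}$ of subgroups of $G$, $G/\mathcal{P}$ denotes the set of all left cosets $gP$ with $g\in G$, $P\in\mathcal{P}$. Hyperbolically embedded: for a collection $\mathcal{P}$ of infinite subgroups of $G$ and $S\subset G$, the coned-off Cayley graph $\hat\Gamma(G,\mathcal{P},S)$ has vertex set $G\cup G/\mathcal{P}$ and edges $\{g,gs\}$ for $g\in G$, $s\in S$, and $\{x,gP\}$ for $g\in G$, $P\in\mathcal{P}$, $x\in gP$. Vertices $gP$ are cone vertices. A graph $\Gamma$ is fine at a vertex $v$ if the set $T_v\Gamma$ of vertices adjacent to $v$, with the metric $\angle_v(x,y)$ = length of a shortest path from $x$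 to $y$ in $\Gamma\setminus\{v\}$ ($\infty$ if none), is locally finite (balls of finite radius are finite). $\mathcal{P}\hookrightarrow_h(G,S)$ means that $\hat\Gamma(G,\mathcal{P},S)$ is a connected (Gromov) hyperbolic graph that is fine at every cone vertex; $\mathcal{P}\hookrightarrow_h G$ means $\mathcal{P}\hookrightarrow_h(G,S)$ for some $S\subset G$. *)

theory Defs
  imports "HOL-Algebra.Algebra" "HOL-Algebra.Left_Coset" "HOL-Library.Extended_Nat"
begin

section \<open>Groups\<close>

definition finitely_generated :: "('a, 'm) monoid_scheme \<Rightarrow> bool" where
  "finitely_generated G \<longleftrightarrow>
     (\<exists>A. finite A \<and> A \<subseteq> carrier G \<and> generate G A = carrier G)"

definition finite_index :: "('a, 'm) monoid_scheme \<Rightarrow> 'a set \<Rightarrow> 'a set \<Rightarrow> bool" where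
  "finite_index G K L \<longleftrightarrow> K \<subseteq> L \<and> finite (rcosets\<^bsub>G\<lparr>carrier := L\<rparr>\<^esub> K)"

definition conj_set :: "('a, 'm) monoid_scheme \<Rightarrow> 'a \<Rightarrow> 'a set \<Rightarrow> 'a set" where
  "conj_set G g A = (g <#\<^bsub>G\<^esub> A) #>\<^bsub>G\<^esub> (inv\<^bsub>G\<^esub> g)"

definition commensurator :: "('a, 'm) monoid_scheme \<Rightarrow> 'a set \<Rightarrow> 'a set" where
  "commensurator G P =
     {g \<in> carrier G. finite_index G (P \<inter> conj_set G g P) P
                   \<and> finite_index G (P \<inter> conj_set G g P) (conj_set G g P)}"

definition is_refinement :: "('a, 'm) monoid_scheme \<Rightarrow> 'a set set \<Rightarrow> 'a set set \<Rightarrow> bool" where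
  "is_refinement G \<P> \<P>' \<longleftrightarrow>
     (let \<C> = {commensurator G (conj_set G g P) | g P. g \<in> carrier G \<and> P \<in> \<P>}
      in \<P>' \<subseteq> \<C> \<and> (\<forall>K\<in>\<C>. \<exists>!L. L \<in> \<P>' \<and> (\<exists>g\<in>carrier G. K = conj_set G g L)))"

section \<open>Graphs\<close>

text \<open>
  A graph is a pair of a vertex set and a set of edges, an edge being the set of its
  endpoints. Singleton edges (loops) are permitted; they affect neither distances nor
  geodesics.
\<close>

type_synonym 'v graph = "'v set \<times> 'v set set"

definition is_walk :: "'v graph \<Rightarrow> 'v list \<Rightarrow> bool" where
  "is_walk \<Gamma> p \<longleftrightarrow>
     p \<noteq> [] \<and> set p \<subseteq> fst \<Gamma> \<and> successively (\<lambda>x y. {x, y} \<in> snd \<Gamma>) p"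

text \<open>The distance is \<open>\<infinity>\<close> (the infimum of the empty set) if there is no walk.\<close>

definition gdist :: "'v graph \<Rightarrow> 'v \<Rightarrow> 'v \<Rightarrow> enat" where
  "gdist \<Gamma> x y = Inf {enat (length p - 1) | p. is_walk \<Gamma> p \<and> hd p = x \<and> last p = y}"

definition connected_graph :: "'v graph \<Rightarrow> bool" where
  "connected_graph \<Gamma> \<longleftrightarrow>
     (\<forall>x\<in>fst \<Gamma>. \<forall>y\<in>fst \<Gamma>. \<exists>p. is_walk \<Gamma> p \<and> hd p = x \<and> last p = y)"

definition geodesic :: "'v graph \<Rightarrow> 'v list \<Rightarrow> 'v \<Rightarrow> 'v \<Rightarrow> bool" where
  "geodesic \<Gamma> p x y \<longleftrightarrow>
     is_walk \<Gamma> p \<and> hd p = x \<and> last p = y \<and> gdist \<Gamma> x y = enat (length p - 1)"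

text \<open>
  Gromov hyperbolicity in Rips' form, that geodesic triangles are uniformly slim.
  Triangles have vertices of the graph as corners and edge paths as sides; passing to
  the geometric realization only changes the constant.
\<close>

definition hyperbolic_graph :: "'v graph \<Rightarrow> bool" where
  "hyperbolic_graph \<Gamma> \<longleftrightarrow>
     (\<exists>\<delta>::nat. \<forall>x y z p q r.
        geodesic \<Gamma> p x y \<and> geodesic \<Gamma> q y z \<and> geodesic \<Gamma> r x z \<longrightarrow>
        (\<forall>u\<in>set p. \<exists>w\<in>set q \<union> set r. gdist \<Gamma> u w \<le> enat \<delta>))"

definition neighbours :: "'v graph \<Rightarrow> 'v \<Rightarrow> 'v set" where
  "neighbours \<Gamma> v = {x \<in> fst \<Gamma>. {v, x} \<in> snd \<Gamma>}"

definition delete_vertex :: "'v graph \<Rightarrow> 'v \<Rightarrow> 'v graph" where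
  "delete_vertex \<Gamma> v = (fst \<Gamma> - {v}, {e \<in> snd \<Gamma>. v \<notin> e})"

definition angle_metric :: "'v graph \<Rightarrow> 'v \<Rightarrow> 'v \<Rightarrow> 'v \<Rightarrow> enat" where
  "angle_metric \<Gamma> v x y = gdist (delete_vertex \<Gamma> v) x y"

definition fine_at :: "'v graph \<Rightarrow> 'v \<Rightarrow> bool" where
  "fine_at \<Gamma> v \<longleftrightarrow>
     (\<forall>x\<in>neighbours \<Gamma> v. \<forall>n::nat.
        finite {y \<in> neighbours \<Gamma> v. angle_metric \<Gamma> v x y \<le> enat n})"

section \<open>Hyperbolically embedded collections\<close>

definition left_cosets :: "('a, 'm) monoid_scheme \<Rightarrow> 'a set set \<Rightarrow> 'a set set" where
  "left_cosets G \<P> = (\<Union>P\<in>\<P>. lcosets\<^bsub>G\<^esub> P)"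

text \<open>
  Vertices \<open>Inl g\<close> are group elements and vertices \<open>Inr C\<close> are cone vertices. No
  information is lost by taking a coset as a bare set, since \<open>gP\<close> determines the
  subgroup \<open>P\<close>.
\<close>

definition coned_off_Cayley_graph ::
  "('a, 'm) monoid_scheme \<Rightarrow> 'a set set \<Rightarrow> 'a set \<Rightarrow> ('a + 'a set) graph" where
  "coned_off_Cayley_graph G \<P> S =
     (Inl ` carrier G \<union> Inr ` left_cosets G \<P>,
      {{Inl g, Inl (g \<otimes>\<^bsub>G\<^esub> s)} | g s. g \<in> carrier G \<and> s \<in> S} \<union>
      {{Inl x, Inr C} | x C. C \<in> left_cosets G \<P> \<and> x \<in> C})"

definition hyp_embedded_wrt ::
  "('a, 'm) monoid_scheme \<Rightarrow> 'a set set \<Rightarrow> 'a set \<Rightarrow> bool" where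
  "hyp_embedded_wrt G \<P> S \<longleftrightarrow>
     (\<forall>P\<in>\<P>. subgroup P G \<and> infinite P) \<and> S \<subseteq> carrier G \<and>
     (let \<Gamma> = coned_off_Cayley_graph G \<P> S
      in connected_graph \<Gamma> \<and> hyperbolic_graph \<Gamma> \<and>
         (\<forall>C\<in>left_cosets G \<P>. fine_at \<Gamma> (Inr C)))"

definition hyp_embedded :: "('a, 'm) monoid_scheme \<Rightarrow> 'a set set \<Rightarrow> bool" where
  "hyp_embedded G \<P> \<longleftrightarrow> (\<exists>S\<subseteq>carrier G. hyp_embedded_wrt G \<P> S)"

end

theory Submission
  imports Defs
begin

text \<open>
  Let \<open>\<Gamma>\<close> be the coned-off Cayley graph of \<open>H\<close> and write \<open>N(A)\<close> for the normalizer of \<open>A\<close> in \<open>G\<close>.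

  Fineness forces the collection \<open>\<Q>\<close> to be almost malnormal in \<open>H\<close>: two cosets with infinite common
  stabilizer coincide (\<open>infinite_stabilizer_unique_cone\<close>). Since conjugation by \<open>G\<close> permutes the
  conjugates \<open>A = h Q h\<inverse>\<close>, the commensurator of \<open>A\<close> in \<open>G\<close> is therefore \<open>N(A)\<close>, and \<open>N(A) \<inter> H = A\<close>.
  A refinement consists of normalizers of this kind, one from each conjugacy class, and in particular
  it is finite. A left coset \<open>C\<close> of one of its members has a stabilizer whose intersection with \<open>H\<close> is
  again some \<open>h Q h\<inverse>\<close>, which is the stabilizer of exactly one coset \<open>h Q\<close>. This sets up an
  \<open>H\<close>-equivariant bijection \<open>H_cone\<close> between the cone vertices of the two graphs.

  Choose a finite transversal of \<open>H\<close> in \<open>G\<close>. Sending \<open>g = h r\<close> to \<open>h\<close>, and cone vertices by the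
  bijection, maps a coned-off graph of \<open>G\<close> to \<open>\<Gamma>\<close>; including \<open>H\<close> in \<open>G\<close> gives a map in the other
  direction. By equivariance, only finitely many elements are needed to join the images of adjacent
  vertices. Invariance of \<open>T\<close> is what takes edges labelled by the possibly infinite set \<open>T\<close> to such
  edges again. Adding the finitely many elements to the generators of \<open>H\<close> does not affect the
  hypothesis (\<open>hyp_embedded_wrt_union_finite\<close>), and afterwards the two maps are Lipschitz. The first
  of them also takes walks that avoid a cone vertex to walks that avoid its image, which transfers
  fineness.

  For hyperbolicity, two such maps suffice (\<open>coarse_inverse_hyperbolic\<close>): the images of geodesics of
  \<open>\<Gamma>\<close> form thin triangles, and by the guessing geodesics criterion a graph with a system of coarse
  paths that form thin triangles is hyperbolic (\<open>guessed_geodesics.hyperbolic\<close>).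
\<close>

section \<open>Walks, distances and geodesics\<close>

text \<open>
  Distances enter all arguments only through upper bounds by natural numbers. The relation
  below is such a bound; unlike the extended distance, it composes by adding bounds and
  transfers along maps without case distinctions on \<open>\<infinity>\<close>.
\<close>

definition near :: "'v graph \<Rightarrow> nat \<Rightarrow> 'v \<Rightarrow> 'v \<Rightarrow> bool" where
  "near \<Gamma> n x y \<longleftrightarrow> (\<exists>p. is_walk \<Gamma> p \<and> hd p = x \<and> last p = y \<and> length p \<le> Suc n)"

lemma gdist_le_iff_near: "gdist \<Gamma> x y \<le> enat n \<longleftrightarrow> near \<Gamma> n x y"
proof -
  define A where "A = {enat (length p - 1) | p. is_walk \<Gamma> p \<and> hd p = x \<and> last p = y}"
  have "gdist \<Gamma> x y = Inf A" by (simp add: gdist_def A_def)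
  show ?thesis
  proof
    assume le: "gdist \<Gamma> x y \<le> enat n"
    then have "A \<noteq> {}" using \<open>gdist \<Gamma> x y = Inf A\<close> by (auto simp: top_enat_def)
    then have "Inf A \<in> A" by (simp add: Inf_enat_def) (meson LeastI_ex ex_in_conv)
    then obtain p where p: "Inf A = enat (length p - 1)" "is_walk \<Gamma> p" "hd p = x" "last p = y"
      unfolding A_def by auto
    then have "length p \<le> Suc n" using le \<open>gdist \<Gamma> x y = Inf A\<close> by auto
    with p show "near \<Gamma> n x y" unfolding near_def by blast
  next
    assume "near \<Gamma> n x y"
    then obtain p where p: "is_walk \<Gamma> p" "hd p = x" "last p = y" "length p \<le> Suc n"
      unfolding near_def by blast
    then have "enat (length p - 1) \<in> A" unfolding A_def by blast
    then have "Inf A \<le> enat (length p - 1)" by (rule Inf_lower)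
    also have "\<dots> \<le> enat n" using p by auto
    finally show "gdist \<Gamma> x y \<le> enat n" using \<open>gdist \<Gamma> x y = Inf A\<close> by simp
  qed
qed

lemma near_mono: "near \<Gamma> m x y \<Longrightarrow> m \<le> n \<Longrightarrow> near \<Gamma> n x y"
  unfolding near_def by (metis Suc_le_mono le_trans)

lemma near_walk: "is_walk \<Gamma> p \<Longrightarrow> near \<Gamma> (length p - 1) (hd p) (last p)"
  unfolding near_def by (intro exI[of _ p]) auto

lemma near_vertices: "near \<Gamma> n x y \<Longrightarrow> x \<in> fst \<Gamma> \<and> y \<in> fst \<Gamma>"
  unfolding near_def is_walk_def by (metis hd_in_set last_in_set subset_iff)

lemma near_refl: "x \<in> fst \<Gamma> \<Longrightarrow> near \<Gamma> n x x"
  unfolding near_def is_walk_def by (intro exI[of _ "[x]"]) auto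

lemma near_edge: "x \<in> fst \<Gamma> \<Longrightarrow> y \<in> fst \<Gamma> \<Longrightarrow> {x, y} \<in> snd \<Gamma> \<Longrightarrow> near \<Gamma> 1 x y"
  unfolding near_def is_walk_def by (intro exI[of _ "[x, y]"]) auto

lemma near_0: "near \<Gamma> 0 x y \<longleftrightarrow> x \<in> fst \<Gamma> \<and> x = y"
proof
  assume "near \<Gamma> 0 x y"
  then obtain p where p: "is_walk \<Gamma> p" "hd p = x" "last p = y" "length p \<le> Suc 0"
    unfolding near_def by blast
  then show "x \<in> fst \<Gamma> \<and> x = y" by (cases p) (auto simp: is_walk_def)
qed (auto intro: near_refl)

lemma is_walk_rev: "is_walk \<Gamma> p \<Longrightarrow> is_walk \<Gamma> (rev p)"
  unfolding is_walk_def by (auto simp: insert_commute)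

lemma near_sym: "near \<Gamma> n x y \<Longrightarrow> near \<Gamma> n y x"
  unfolding near_def using is_walk_rev
  by (metis hd_rev last_rev length_rev)

lemma is_walk_append:
  assumes "is_walk \<Gamma> p" "is_walk \<Gamma> q" "last p = hd q"
  shows "is_walk \<Gamma> (p @ tl q)" "hd (p @ tl q) = hd p" "last (p @ tl q) = last q"
proof -
  from assms obtain a q' where q: "q = a # q'" by (cases q) (auto simp: is_walk_def)
  show "is_walk \<Gamma> (p @ tl q)" "hd (p @ tl q) = hd p" "last (p @ tl q) = last q"
    using assms unfolding q is_walk_def by (auto simp: successively_append_iff successively_Cons)
qed

lemma near_trans: "near \<Gamma> m x y \<Longrightarrow> near \<Gamma> n y z \<Longrightarrow> near \<Gamma> (m + n) x z"
proof -
  assume "near \<Gamma> m x y" "near \<Gamma> n y z"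
  then obtain p q where p: "is_walk \<Gamma> p" "hd p = x" "last p = y" "length p \<le> Suc m"
    and q: "is_walk \<Gamma> q" "hd q = y" "last q = z" "length q \<le> Suc n"
    unfolding near_def by blast
  with is_walk_append[OF p(1) q(1)] show ?thesis
    unfolding near_def by (intro exI[of _ "p @ tl q"]) auto
qed

text \<open>
  Splitting off the last edge is the form in which walks of bounded length are used in
  inductions.
\<close>

lemma near_Suc: "near \<Gamma> (Suc n) x z \<longleftrightarrow>
   near \<Gamma> n x z \<or> (\<exists>y. near \<Gamma> n x y \<and> z \<in> fst \<Gamma> \<and> {y, z} \<in> snd \<Gamma>)"
proof
  assume "near \<Gamma> (Suc n) x z"
  then obtain p where p: "is_walk \<Gamma> p" "hd p = x" "last p = z" "length p \<le> Suc (Suc n)"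
    unfolding near_def by blast
  show "near \<Gamma> n x z \<or> (\<exists>y. near \<Gamma> n x y \<and> z \<in> fst \<Gamma> \<and> {y, z} \<in> snd \<Gamma>)"
  proof (cases "length p \<le> Suc n")
    case True then show ?thesis using p unfolding near_def by blast
  next
    case False
    then have "p = butlast p @ [z]" "butlast p \<noteq> []"
      using p by (auto simp: is_walk_def simp flip: length_greater_0_conv)
    then obtain q where q: "p = q @ [z]" "q \<noteq> []" by blast
    then have "near \<Gamma> n x (last q)" "z \<in> fst \<Gamma> \<and> {last q, z} \<in> snd \<Gamma>"
      using p unfolding near_def
      by (auto simp: is_walk_def successively_append_iff intro!: exI[of _ q])
    then show ?thesis by blast
  qed
next
  assume "near \<Gamma> n x z \<or> (\<exists>y. near \<Gamma> n x y \<and> z \<in> fst \<Gamma> \<and> {y, z} \<in> snd \<Gamma>)"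
  then show "near \<Gamma> (Suc n) x z"
  proof (elim disjE exE conjE)
    fix y assume "near \<Gamma> n x y" "z \<in> fst \<Gamma>" "{y, z} \<in> snd \<Gamma>"
    then have "near \<Gamma> 1 y z" by (intro near_edge) (auto dest: near_vertices)
    with \<open>near \<Gamma> n x y\<close> have "near \<Gamma> (n + 1) x z" by (rule near_trans)
    then show ?thesis by simp
  qed (simp add: near_mono)
qed

lemma near_lipschitz:
  assumes "near \<Gamma> n x y" and "\<And>a. a \<in> fst \<Gamma> \<Longrightarrow> f a \<in> fst \<Delta>"
    and "\<And>a b. a \<in> fst \<Gamma> \<Longrightarrow> b \<in> fst \<Gamma> \<Longrightarrow> {a, b} \<in> snd \<Gamma> \<Longrightarrow> near \<Delta> k (f a) (f b)"
  shows "near \<Delta> (n * k) (f x) (f y)"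
  using assms(1)
proof (induction n arbitrary: y)
  case 0 then show ?case by (auto simp: near_0 assms(2))
next
  case (Suc n)
  then consider "near \<Gamma> n x y" | z where "near \<Gamma> n x z" "y \<in> fst \<Gamma>" "{z, y} \<in> snd \<Gamma>"
    by (auto simp: near_Suc)
  then show ?case
  proof cases
    case 1 then show ?thesis using Suc.IH[OF 1] by (auto intro: near_mono)
  next
    case 2
    have "near \<Delta> (n * k + k) (f x) (f y)"
      using near_vertices[OF 2(1)] by (intro near_trans[OF Suc.IH[OF 2(1)] assms(3)[OF _ 2(2,3)]]) simp
    then show ?thesis by (simp add: add.commute)
  qed
qed

lemma connected_graph_iff_near:
  "connected_graph \<Gamma> \<longleftrightarrow> (\<forall>x\<in>fst \<Gamma>. \<forall>y\<in>fst \<Gamma>. \<exists>n. near \<Gamma> n x y)"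
proof -
  have "(\<exists>p. is_walk \<Gamma> p \<and> hd p = x \<and> last p = y) \<longleftrightarrow> (\<exists>n. near \<Gamma> n x y)" for x y
  proof
    assume "\<exists>p. is_walk \<Gamma> p \<and> hd p = x \<and> last p = y"
    then show "\<exists>n. near \<Gamma> n x y" using near_walk by metis
  qed (auto simp: near_def)
  then show ?thesis unfolding connected_graph_def by simp
qed

lemma geodesic_iff_near:
  "geodesic \<Gamma> p x y \<longleftrightarrow> is_walk \<Gamma> p \<and> hd p = x \<and> last p = y \<and>
     (\<forall>n. near \<Gamma> n x y \<longrightarrow> length p \<le> Suc n)"
proof -
  have "gdist \<Gamma> x y = enat (length p - 1) \<longleftrightarrow> (\<forall>n. near \<Gamma> n x y \<longrightarrow> length p \<le> Suc n)"
    if p: "is_walk \<Gamma> p" "hd p = x" "last p = y"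
  proof -
    have le: "gdist \<Gamma> x y \<le> enat (length p - 1)"
      unfolding gdist_le_iff_near using near_walk p by blast
    show ?thesis
    proof
      assume eq: "gdist \<Gamma> x y = enat (length p - 1)"
      show "\<forall>n. near \<Gamma> n x y \<longrightarrow> length p \<le> Suc n"
        using eq by (auto simp: gdist_le_iff_near[symmetric])
    next
      assume a: "\<forall>n. near \<Gamma> n x y \<longrightarrow> length p \<le> Suc n"
      obtain m where m: "gdist \<Gamma> x y = enat m" using le by (meson enat_ile)
      then have "near \<Gamma> m x y" by (simp add: gdist_le_iff_near[symmetric])
      with a have "length p \<le> Suc m" by blast
      with le m show "gdist \<Gamma> x y = enat (length p - 1)" by auto
    qed
  qed
  then show ?thesis unfolding geodesic_def by blast
qed

lemma geodesic_vertices: "geodesic \<Gamma> p x y \<Longrightarrow> x \<in> fst \<Gamma> \<and> y \<in> fst \<Gamma>"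
  unfolding geodesic_def using near_vertices near_walk by metis

lemma geodesic_rev: "geodesic \<Gamma> p x y \<Longrightarrow> geodesic \<Gamma> (rev p) y x"
  unfolding geodesic_iff_near
  by (auto simp: is_walk_rev hd_rev last_rev intro: near_sym)

lemma ex_geodesic:
  assumes "connected_graph \<Gamma>" "x \<in> fst \<Gamma>" "y \<in> fst \<Gamma>"
  shows "\<exists>p. geodesic \<Gamma> p x y"
proof -
  obtain n where "near \<Gamma> n x y" using assms unfolding connected_graph_iff_near by blast
  define m where "m = (LEAST n. near \<Gamma> n x y)"
  have m: "near \<Gamma> m x y" "\<And>n. near \<Gamma> n x y \<Longrightarrow> m \<le> n"
    unfolding m_def using \<open>near \<Gamma> n x y\<close> by (auto intro: LeastI Least_le)
  then obtain p where "is_walk \<Gamma> p" "hd p = x" "last p = y" "length p \<le> Suc m"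
    unfolding near_def by blast
  with m(2) show ?thesis unfolding geodesic_iff_near
    by (intro exI[of _ p]) (auto intro: le_trans)
qed

text \<open>Both end positions are included, so that consecutive segments share a vertex.\<close>

definition segment :: "nat \<Rightarrow> nat \<Rightarrow> 'v list \<Rightarrow> 'v list" where
  "segment i j p = take (Suc j - i) (drop i p)"

lemma segment:
  assumes "is_walk \<Gamma> p" "i \<le> j" "j < length p"
  shows "is_walk \<Gamma> (segment i j p)" "hd (segment i j p) = p ! i" "last (segment i j p) = p ! j"
    "length (segment i j p) = Suc (j - i)" "set (segment i j p) = (!) p ` {i..j}"
proof -
  let ?s = "segment i j p"
  show len: "length ?s = Suc (j - i)" using assms by (auto simp: segment_def)
  have nth: "?s ! k = p ! (i + k)" if "k < length ?s" for k
    using that assms len by (auto simp: segment_def)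
  have ne: "?s \<noteq> []" using len by auto
  show "hd ?s = p ! i" using ne nth[of 0] by (simp add: hd_conv_nth)
  show "last ?s = p ! j" using ne nth[of "j - i"] len assms by (simp add: last_conv_nth)
  show "set ?s = (!) p ` {i..j}"
  proof
    show "set ?s \<subseteq> (!) p ` {i..j}"
      using nth len assms(2) by (auto simp: in_set_conv_nth intro!: imageI)
    show "(!) p ` {i..j} \<subseteq> set ?s"
    proof
      fix a assume "a \<in> (!) p ` {i..j}"
      then obtain k where k: "i \<le> k" "k \<le> j" "a = p ! k" by auto
      then have "k - i < length ?s" using len by auto
      moreover from this have "?s ! (k - i) = a" using nth k by simp
      ultimately show "a \<in> set ?s" using nth_mem by metis
    qed
  qed
  have "p = take i p @ ?s @ drop (Suc j - i) (drop i p)"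
    unfolding segment_def by (simp only: append_take_drop_id)
  then have "successively (\<lambda>x y. {x, y} \<in> snd \<Gamma>) (take i p @ ?s @ drop (Suc j - i) (drop i p))"
    using assms(1) unfolding is_walk_def by simp
  then have "successively (\<lambda>x y. {x, y} \<in> snd \<Gamma>) ?s"
    by (simp only: successively_append_iff)
  moreover have "set ?s \<subseteq> set p" by (auto simp: segment_def dest: in_set_takeD in_set_dropD)
  ultimately show "is_walk \<Gamma> ?s" using assms(1) ne unfolding is_walk_def by blast
qed

lemma near_segment:
  assumes "is_walk \<Gamma> p" "i \<le> j" "j < length p"
  shows "near \<Gamma> (j - i) (p ! i) (p ! j)"
  unfolding near_def using segment[OF assms] by (intro exI[of _ "segment i j p"]) auto

lemma geodesic_position_le:
  assumes p: "geodesic \<Gamma> p x y" and ij: "i \<le> j" "j < length p"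
    and w: "near \<Gamma> n (p ! i) (p ! j)"
  shows "j - i \<le> n"
proof -
  have wp: "is_walk \<Gamma> p" "hd p = x" "last p = y" and len: "\<And>n. near \<Gamma> n x y \<Longrightarrow> length p \<le> Suc n"
    using p unfolding geodesic_iff_near by auto
  have ne: "p \<noteq> []" using ij by auto
  have "near \<Gamma> i x (p ! i)" using near_segment[OF wp(1), of 0 i] ij wp(2) ne
    by (simp add: hd_conv_nth)
  moreover have "near \<Gamma> (length p - 1 - j) (p ! j) y"
    using near_segment[OF wp(1), of j "length p - 1"] ij wp(3) ne by (simp add: last_conv_nth)
  ultimately have "near \<Gamma> (i + n + (length p - 1 - j)) x y" using w
    by (blast intro: near_trans)
  then show ?thesis using len[of "i + n + (length p - 1 - j)"] ij by linarith
qed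

lemma geodesic_segment:
  assumes p: "geodesic \<Gamma> p x y" and ij: "i \<le> j" "j < length p"
  shows "geodesic \<Gamma> (segment i j p) (p ! i) (p ! j)"
  using segment[of \<Gamma> p i j] geodesic_position_le[OF p ij] ij p unfolding geodesic_iff_near by auto

section \<open>Guessing geodesics\<close>

text \<open>
  The coarse paths \<open>L x y\<close> are candidates for geodesics. The criterion of Bowditch and of
  Masur and Schleimer says that thin triangles of candidates, together with triviality of the
  candidates between adjacent vertices, force the graph to be hyperbolic and the candidates to
  run close to geodesics.
\<close>

locale guessed_geodesics =
  fixes \<Gamma> :: "'v graph" and L :: "'v \<Rightarrow> 'v \<Rightarrow> 'v list" and D :: nat
  assumes path: "x \<in> fst \<Gamma> \<Longrightarrow> y \<in> fst \<Gamma> \<Longrightarrow>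
      L x y \<noteq> [] \<and> near \<Gamma> D x (hd (L x y)) \<and> near \<Gamma> D (last (L x y)) y
        \<and> successively (near \<Gamma> D) (L x y)"
    and short: "near \<Gamma> 1 x y \<Longrightarrow> u \<in> set (L x y) \<Longrightarrow> near \<Gamma> D u x"
    and slim: "x \<in> fst \<Gamma> \<Longrightarrow> y \<in> fst \<Gamma> \<Longrightarrow> z \<in> fst \<Gamma> \<Longrightarrow> u \<in> set (L x y) \<Longrightarrow>
      \<exists>w\<in>set (L x z) \<union> set (L z y). near \<Gamma> D u w"
begin

text \<open>
  Halving the walk \<open>k\<close> times leaves edges, whose candidates lie near their end points. Every
  halving replaces a candidate by two, at a cost of \<open>D\<close>. The bound is hence logarithmic in the
  length of an arbitrary walk.
\<close>

lemma near_walk_log: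
  assumes "is_walk \<Gamma> p" "length p \<le> Suc (2 ^ k)" "u \<in> set (L (hd p) (last p))"
  shows "\<exists>w\<in>set p. near \<Gamma> (D * Suc k) u w"
  using assms
proof (induction k arbitrary: p u)
  case 0
  then have "near \<Gamma> 1 (hd p) (last p)" unfolding near_def by auto
  with short 0 have "near \<Gamma> D u (hd p)" by blast
  then show ?case using 0 by (auto simp: is_walk_def)
next
  case (Suc k)
  show ?case
  proof (cases "length p \<le> Suc (2 ^ k)")
    case True
    with Suc obtain w where "w \<in> set p" "near \<Gamma> (D * Suc k) u w" by blast
    then show ?thesis by (auto intro!: bexI[of _ w] elim: near_mono)
  next
    case False
    have ne: "p \<noteq> []" using Suc by (auto simp: is_walk_def)
    let ?m = "2 ^ k :: nat" and ?n = "length p - 1"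
    have len: "?m < length p" "?m \<le> ?n" "?n < length p" using False ne by auto
    note s1 = segment[OF Suc.prems(1) _ len(1), of 0] and s2 = segment[OF Suc.prems(1) len(2,3)]
    have ends: "p ! 0 = hd p" "p ! ?n = last p" using ne by (auto simp: hd_conv_nth last_conv_nth)
    have vs: "hd p \<in> fst \<Gamma>" "last p \<in> fst \<Gamma>" "p ! ?m \<in> fst \<Gamma>"
      using Suc.prems(1) len(1) ne nth_mem unfolding is_walk_def by fastforce+
    obtain w where w: "w \<in> set (L (hd p) (p ! ?m)) \<union> set (L (p ! ?m) (last p))" "near \<Gamma> D u w"
      using slim[OF vs Suc.prems(3)] by blast
    have "\<exists>w'\<in>set (segment 0 ?m p) \<union> set (segment ?m ?n p). near \<Gamma> (D * Suc k) w w'"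
      using w(1)
    proof
      assume "w \<in> set (L (hd p) (p ! ?m))"
      then show ?thesis using Suc.IH[OF s1(1), of w] s1 ends by auto
    next
      assume "w \<in> set (L (p ! ?m) (last p))"
      moreover have "length (segment ?m ?n p) \<le> Suc (2 ^ k)" using s2(4) Suc.prems(2) by simp
      ultimately show ?thesis using Suc.IH[OF s2(1), of w] s2(2,3) ends by auto
    qed
    then obtain w' where w': "w' \<in> set (segment 0 ?m p) \<union> set (segment ?m ?n p)"
      "near \<Gamma> (D * Suc k) w w'" by blast
    have "w' \<in> set p" using w'(1) unfolding segment_def by (auto dest: in_set_takeD in_set_dropD)
    moreover have "near \<Gamma> (D * Suc (Suc k)) u w'" using near_trans[OF w(2) w'(2)] by simp
    ultimately show ?thesis by blast
  qed
qed

end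

text \<open>
  Logarithms grow more slowly than linear functions, which is what lets the logarithmic bound
  limit distances to geodesics.
\<close>

lemma ex_linear_le_power_two: "\<exists>k0. \<forall>k\<ge>k0. a * k + b \<le> (2::nat) ^ k"
proof -
  define m where "m = 2 * a + b"
  have pow: "Suc m \<le> 2 ^ m" using less_exp[of m] by linarith
  have sq: "Suc m * Suc m \<le> 2 ^ (2 * m)"
    using mult_le_mono[OF pow pow] by (simp add: mult_2 power_add)
  have base: "a * (2 * m) + b \<le> 2 ^ (2 * m)" "a \<le> 2 ^ (2 * m)"
  proof -
    have "2 * a \<le> m" unfolding m_def by simp
    from mult_le_mono1[OF this, of m] have "a * (2 * m) \<le> m * m" by (simp add: ac_simps)
    then show "a * (2 * m) + b \<le> 2 ^ (2 * m)" "a \<le> 2 ^ (2 * m)"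
      using sq unfolding mult_Suc mult_Suc_right by (simp_all add: m_def)
  qed
  have "a * k + b \<le> 2 ^ k \<and> a \<le> 2 ^ k" if "2 * m \<le> k" for k
    using that by (induction k rule: dec_induct) (use base in auto)
  then show ?thesis by blast
qed

lemma successively_switch:
  "successively P q \<Longrightarrow> q \<noteq> [] \<Longrightarrow> Q (hd q) \<Longrightarrow> \<not> Q (last q) \<Longrightarrow>
     \<exists>a\<in>set q. \<exists>b\<in>set q. Q a \<and> \<not> Q b \<and> P a b"
proof (induction q)
  case (Cons a q)
  then show ?case by (cases q) auto
qed simp

context guessed_geodesics begin

text \<open>
  Among geodesics of bounded length, choose one with a vertex \<open>u\<close> of the candidate as far from
  it as possible, at distance about \<open>r\<close>. Cut the geodesic at distance \<open>M\<close>, a little more than \<open>2r\<close>,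
  on either side of a point nearest to \<open>u\<close>. Up to \<open>2D\<close>, the vertex \<open>u\<close> lies on the candidate
  of one of the three pieces. It cannot belong to an outer piece, since it would then be within
  about \<open>r\<close> of that piece by maximality, although the outer pieces are further away. So it belongs
  to the middle piece, which has length at most \<open>2M\<close>, and the logarithmic estimate bounds \<open>r\<close> by
  about \<open>D log r\<close>. This bounds \<open>r\<close> in terms of \<open>D\<close> alone.
\<close>

lemma near_geodesic:
  "\<exists>R. \<forall>x y p. \<forall>u\<in>set (L x y). geodesic \<Gamma> p x y \<longrightarrow> (\<exists>w\<in>set p. near \<Gamma> R u w)"
proof -
  obtain k0 where k0: "\<And>k. k \<ge> k0 \<Longrightarrow> (4 * Suc D) * k + (20 * Suc D + 10) \<le> 2 ^ k"
    using ex_linear_le_power_two by meson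
  \<comment> \<open>The constants leave room for the logarithmic estimate with exponent \<open>k\<close>, where \<open>r\<close> lies
    between \<open>(D + 1)(k + 3)\<close> and \<open>(D + 1)(k + 4)\<close>, so that \<open>2 * M \<le> 2 ^ k\<close>.\<close>
  define R0 where "R0 = Suc D * (k0 + 3)"
  define far where "far n r x y p u \<longleftrightarrow> u \<in> set (L x y) \<and> geodesic \<Gamma> p x y \<and> length p \<le> n
    \<and> (\<forall>w\<in>set p. \<not> near \<Gamma> r u w)" for n r x y p u
  \<comment> \<open>The length bound \<open>n\<close> serves only to make a maximal \<open>r\<close> exist; the resulting bound does
    not depend on it.\<close>
  have "\<not> far n R0 x y p u" for n x y p u
  proof
    assume "far n R0 x y p u"
    define Bad where "Bad r \<longleftrightarrow> (\<exists>x y p u. far n r x y p u)" for r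
    have "Bad R0" using \<open>far n R0 x y p u\<close> unfolding Bad_def by blast
    have bound: "r \<le> D * Suc n" if "Bad r" for r
    proof (rule ccontr)
      assume r: "\<not> r \<le> D * Suc n"
      obtain x y p u where f: "far n r x y p u" using \<open>Bad r\<close> unfolding Bad_def by blast
      then have "length p \<le> Suc (2 ^ n)" using less_exp[of n] unfolding far_def by linarith
      then obtain w where "w \<in> set p" "near \<Gamma> (D * Suc n) u w"
        using near_walk_log[of p n u] f unfolding far_def geodesic_def by blast
      then show False using f r near_mono[of \<Gamma> "D * Suc n" u w r] unfolding far_def by auto
    qed
    obtain r where r: "Bad r" "\<And>s. Bad s \<Longrightarrow> s \<le> r"
      using Nat.ex_has_greatest_nat[of Bad R0 "D * Suc n"] \<open>Bad R0\<close> bound by blast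
    have "R0 \<le> r" using r(2) \<open>Bad R0\<close> .
    define k where "k = r div Suc D - 3"
    have "k0 + 3 \<le> r div Suc D"
      using div_le_mono[OF \<open>R0 \<le> r\<close>, of "Suc D"]
      unfolding R0_def by (simp del: mult_Suc)
    then have k: "k0 \<le> k" "r div Suc D = k + 3" unfolding k_def by auto
    have low: "Suc D * (k + 3) \<le> r" using times_div_less_eq_dividend[of "Suc D" r] k(2) by simp
    have "r < Suc D * Suc (k + 3)" using dividend_less_times_div[of "Suc D" r] k(2)
      by (simp add: algebra_simps)
    define M where "M = 2 * r + 2 * D + 3"
    have "2 * M = 4 * r + 4 * D + 6" unfolding M_def by simp
    also have "\<dots> \<le> (4 * Suc D) * k + (20 * Suc D + 10)"
      using \<open>r < Suc D * Suc (k + 3)\<close> by (simp add: algebra_simps)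
    also have "\<dots> \<le> 2 ^ k" by (rule k0[OF k(1)])
    finally have M: "2 * M \<le> 2 ^ k" .
    have near_max: "\<exists>w\<in>set p. near \<Gamma> (Suc r) u w"
      if "u \<in> set (L x y)" "geodesic \<Gamma> p x y" "length p \<le> n" for x y p u
    proof (rule ccontr)
      assume "\<not> (\<exists>w\<in>set p. near \<Gamma> (Suc r) u w)"
      then have "Bad (Suc r)" unfolding Bad_def far_def using that by blast
      then show False using r(2) by fastforce
    qed
    obtain x y p u where f: "u \<in> set (L x y)" "geodesic \<Gamma> p x y" "length p \<le> n"
      "\<And>w. w \<in> set p \<Longrightarrow> \<not> near \<Gamma> r u w"
      using r(1) unfolding Bad_def far_def by blast
    have wp: "is_walk \<Gamma> p" "hd p = x" "last p = y" "p \<noteq> []"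
      using f(2) unfolding geodesic_def is_walk_def by auto
    obtain i where i: "i < length p" "near \<Gamma> (Suc r) u (p ! i)"
      using near_max[OF f(1-3)] by (auto simp: in_set_conv_nth)
    have no: False if "j < length p" "s \<le> r" "near \<Gamma> s u (p ! j)" for j s
      using f(4)[OF nth_mem[OF that(1)]] near_mono[OF that(3,2)] by blast
    let ?n = "length p - 1"
    \<comment> \<open>Near an end of the geodesic the cut is made at that end; the outer piece is then trivial.\<close>
    define a b where "a = i - M" and "b = min (i + M) ?n"
    have ab: "a \<le> b" "b < length p" "a < length p" "b \<le> ?n" "?n < length p" "a \<le> i" "i \<le> b"
      using i wp(4) unfolding a_def b_def by (auto simp: min_def)
    have ends: "p ! 0 = x" "p ! ?n = y" using wp by (auto simp: hd_conv_nth last_conv_nth)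
    have vs: "p ! j \<in> fst \<Gamma>" if "j < length p" for j
      using that wp(1) nth_mem unfolding is_walk_def by blast
    have sub: "\<exists>l. c \<le> l \<and> l \<le> d \<and> near \<Gamma> (Suc r) w (p ! l)"
      if "w \<in> set (L (p ! c) (p ! d))" "c \<le> d" "d < length p" for w c d
    proof -
      note s = segment[OF wp(1) that(2,3)]
      have "\<exists>w'\<in>set (segment c d p). near \<Gamma> (Suc r) w w'"
        using near_max[OF that(1) geodesic_segment[OF f(2) that(2,3)]] s(4) f(3) that by simp
      then show ?thesis unfolding s(5) by auto
    qed
    have middle: False if w: "w \<in> set (L (p ! a) (p ! b))" "near \<Gamma> (2 * D) u w" for w
    proof -
      note s = segment[OF wp(1) ab(1,2)]
      have "b - a \<le> 2 * M" unfolding a_def b_def by auto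
      then have "length (segment a b p) \<le> Suc (2 ^ k)" using s(4) M by simp
      then obtain l where l: "l \<le> b" "near \<Gamma> (D * Suc k) w (p ! l)"
        using near_walk_log[OF s(1), of k w] w(1) s by auto
      have "near \<Gamma> (2 * D + D * Suc k) u (p ! l)" by (rule near_trans[OF w(2) l(2)])
      moreover have "2 * D + D * Suc k \<le> r" using low by (simp add: algebra_simps)
      ultimately show False using no[of l] l(1) ab(2) by simp
    qed
    have left: False if w: "w \<in> set (L x (p ! a))" "near \<Gamma> (2 * D) u w" for w
    proof (cases "M \<le> i")
      case True
      obtain l where l: "l \<le> a" "near \<Gamma> (Suc r) w (p ! l)"
        using sub[of w 0 a] w(1) ab ends by auto
      have up: "near \<Gamma> (2 * D + Suc r) (p ! l) u"
        using near_trans[OF w(2) l(2)] by (rule near_sym)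
      have "i - l \<le> 2 * D + Suc r + Suc r"
        by (rule geodesic_position_le[OF f(2) _ i(1) near_trans[OF up i(2)]]) (use l ab in linarith)
      then show False using l True unfolding a_def M_def by linarith
    next
      case False
      then have "p ! a = x" unfolding a_def using ends by simp
      then have "near \<Gamma> D w (p ! a)"
        using short[of x x w] w(1) near_refl[of x \<Gamma> 1] vs[OF ab(3)] by simp
      from near_trans[OF w(2) this] have "near \<Gamma> (2 * D + D) u (p ! a)" .
      moreover have "2 * D + D \<le> r" using low by (simp add: algebra_simps)
      ultimately show False using no ab(3) by blast
    qed
    have right: False if w: "w \<in> set (L (p ! b) y)" "near \<Gamma> (2 * D) u w" for w
    proof (cases "i + M \<le> ?n")
      case True
      obtain l where l: "b \<le> l" "l \<le> ?n" "near \<Gamma> (Suc r) w (p ! l)"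
        using sub[of w b ?n] w(1) ab ends by auto
      have up: "near \<Gamma> (2 * D + Suc r) u (p ! l)"
        using near_trans[OF w(2) l(3)] .
      have "l - i \<le> Suc r + (2 * D + Suc r)"
        by (rule geodesic_position_le[OF f(2) _ _ near_trans[OF near_sym[OF i(2)] up]])
          (use l ab in linarith)+
      then show False using l True unfolding b_def M_def by linarith
    next
      case False
      then have "p ! b = y" unfolding b_def using ends by simp
      then have "near \<Gamma> D w (p ! b)"
        using short[of y y w] w(1) near_refl[of y \<Gamma> 1] vs[OF ab(2)] by simp
      from near_trans[OF w(2) this] have "near \<Gamma> (2 * D + D) u (p ! b)" .
      moreover have "2 * D + D \<le> r" using low by (simp add: algebra_simps)
      ultimately show False using no ab(2) by blast
    qed
    have xy: "x \<in> fst \<Gamma>" "y \<in> fst \<Gamma>" using vs[of 0] vs[of ?n] ends ab wp(4) by auto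
    obtain w where w: "w \<in> set (L x (p ! a)) \<union> set (L (p ! a) y)" "near \<Gamma> D u w"
      using slim[OF xy vs[OF ab(3)] f(1)] by blast
    have "near \<Gamma> (2 * D) u w" using w(2) by (rule near_mono) simp
    with w(1) left have w1: "w \<in> set (L (p ! a) y)" by blast
    obtain w' where w': "w' \<in> set (L (p ! a) (p ! b)) \<union> set (L (p ! b) y)" "near \<Gamma> D w w'"
      using slim[OF vs[OF ab(3)] xy(2) vs[OF ab(2)] w1] by blast
    have "near \<Gamma> (2 * D) u w'" using near_trans[OF w(2) w'(2)] by (simp add: mult_2)
    with w'(1) middle right show False by blast
  qed
  then show ?thesis unfolding far_def by (meson order_refl)
qed

text \<open>
  Conversely, let \<open>v\<close> split a geodesic into an early and a late part. Every vertex of the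
  candidate is near one of them, the beginning is near the early part and the end near the
  late part. Where the candidate changes from one to the other, it is near points of both
  parts, and \<open>v\<close> lies between these two points.
\<close>

lemma geodesic_near_guess:
  "\<exists>R. \<forall>x y p. \<forall>v\<in>set p. geodesic \<Gamma> p x y \<longrightarrow> (\<exists>u\<in>set (L x y). near \<Gamma> R v u)"
proof -
  obtain R where R: "\<And>x y p u. u \<in> set (L x y) \<Longrightarrow> geodesic \<Gamma> p x y \<Longrightarrow> \<exists>w\<in>set p. near \<Gamma> R u w"
    using near_geodesic by meson
  define S where "S = R + D + R"
  have "\<exists>u\<in>set (L x y). near \<Gamma> (S + R + D) v u" if p: "geodesic \<Gamma> p x y" and v: "v \<in> set p" for x y p v
  proof -
    have wp: "is_walk \<Gamma> p" "hd p = x" "last p = y" "p \<noteq> []"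
      using p unfolding geodesic_def is_walk_def by auto
    have vs: "x \<in> fst \<Gamma>" "y \<in> fst \<Gamma>"
      using wp unfolding is_walk_def by (metis hd_in_set subset_iff, metis last_in_set subset_iff)
    obtain i where i: "i < length p" "v = p ! i" using v by (auto simp: in_set_conv_nth)
    note path = path[OF vs]
    define early where "early u \<longleftrightarrow> (\<exists>l\<le>i. near \<Gamma> R u (p ! l))" for u
    define late where "late u \<longleftrightarrow> (\<exists>l\<ge>i. l < length p \<and> near \<Gamma> R u (p ! l))" for u
    have cover: "early u \<or> late u" if "u \<in> set (L x y)" for u
      using R[OF that p] unfolding early_def late_def by (metis in_set_conv_nth nat_le_linear)
    have meet: "near \<Gamma> (S + R) v u" if u: "early u" and u': "late u'" and "near \<Gamma> D u u'" for u u'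
    proof -
      obtain l where l: "l \<le> i" "near \<Gamma> R u (p ! l)" using u unfolding early_def by blast
      obtain l' where l': "i \<le> l'" "l' < length p" "near \<Gamma> R u' (p ! l')"
        using u' unfolding late_def by blast
      have "near \<Gamma> S (p ! l) (p ! l')"
        unfolding S_def using near_sym[OF l(2)] \<open>near \<Gamma> D u u'\<close> l'(3) by (blast intro: near_trans)
      then have "l' - l \<le> S"
        using l(1) l'(1,2) geodesic_position_le[OF p] by (meson le_trans)
      have "near \<Gamma> (i - l) (p ! l) v" using near_segment[OF wp(1) l(1) i(1)] i(2) by simp
      from near_mono[OF near_sym[OF this], of S] have "near \<Gamma> S v (p ! l)"
        using \<open>l' - l \<le> S\<close> l'(1) by simp
      from near_trans[OF this near_sym[OF l(2)]] show ?thesis .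
    qed
    obtain q where q: "q = L x y" "q \<noteq> []" "near \<Gamma> D x (hd q)" "near \<Gamma> D (last q) y"
      "successively (near \<Gamma> D) q" using path by blast
    consider "\<not> early (hd q)" | "early (last q)" | "early (hd q)" "\<not> early (last q)" by blast
    then show ?thesis
    proof cases
      case 1
      then have "late (hd q)" using cover[of "hd q"] hd_in_set[OF q(2)] q(1) by blast
      moreover have "early x" unfolding early_def
        using near_refl[OF vs(1)] wp by (intro exI[of _ 0]) (auto simp: hd_conv_nth)
      ultimately have "near \<Gamma> (S + R) v x" by (intro meet[OF _ _ q(3)])
      from near_trans[OF this q(3)] show ?thesis using q(1,2) by auto
    next
      case 2
      moreover have "late y" unfolding late_def
        using near_refl[OF vs(2)] wp i(1) by (intro exI[of _ "length p - 1"]) (auto simp: last_conv_nth)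
      ultimately have "near \<Gamma> (S + R) v (last q)" by (intro meet[OF _ _ q(4)])
      then have "near \<Gamma> (S + R + D) v (last q)" by (rule near_mono) simp
      then show ?thesis using q(1,2) by auto
    next
      case 3
      then obtain u u' where u: "u \<in> set q" "u' \<in> set q" "early u" "\<not> early u'" "near \<Gamma> D u u'"
        using successively_switch[OF q(5,2), of early] by blast
      have "late u'" using cover u q(1) by blast
      with u(3) have "near \<Gamma> (S + R) v u" by (rule meet[OF _ _ u(5)])
      then have "near \<Gamma> (S + R + D) v u" by (rule near_mono) simp
      then show ?thesis using q(1) u(1) by auto
    qed
  qed
  then show ?thesis by blast
qed

text \<open>
  Each side of a geodesic triangle may be replaced by its candidate, and candidates are thin.
\<close>

lemma hyperbolic: "hyperbolic_graph \<Gamma>"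
proof -
  obtain R where R: "\<And>x y p u. u \<in> set (L x y) \<Longrightarrow> geodesic \<Gamma> p x y \<Longrightarrow> \<exists>w\<in>set p. near \<Gamma> R u w"
    using near_geodesic by meson
  obtain R' where R': "\<And>x y p v. v \<in> set p \<Longrightarrow> geodesic \<Gamma> p x y \<Longrightarrow> \<exists>u\<in>set (L x y). near \<Gamma> R' v u"
    using geodesic_near_guess by meson
  have "\<exists>w\<in>set q \<union> set r. near \<Gamma> (R' + D + R) v w"
    if g: "geodesic \<Gamma> p x y" "geodesic \<Gamma> q y z" "geodesic \<Gamma> r x z" and v: "v \<in> set p" for x y z p q r v
  proof -
    have vs: "x \<in> fst \<Gamma>" "y \<in> fst \<Gamma>" "z \<in> fst \<Gamma>"
      using geodesic_vertices[OF g(1)] geodesic_vertices[OF g(2)] by auto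
    obtain u where u: "u \<in> set (L x y)" "near \<Gamma> R' v u" using R'[OF v g(1)] by blast
    obtain w where w: "w \<in> set (L x z) \<union> set (L z y)" "near \<Gamma> D u w" using slim[OF vs u(1)] by blast
    have "\<exists>w'\<in>set q \<union> set r. near \<Gamma> R w w'"
      using w(1) R[OF _ g(3), of w] R[OF _ geodesic_rev[OF g(2)], of w] by auto
    then obtain w' where w': "w' \<in> set q \<union> set r" "near \<Gamma> R w w'" by blast
    have "near \<Gamma> (R' + D + R) v w'" by (rule near_trans[OF near_trans[OF u(2) w(2)] w'(2)])
    with w'(1) show ?thesis by blast
  qed
  then show ?thesis unfolding hyperbolic_graph_def gdist_le_iff_near
    by (intro exI[of _ "R' + D + R"]) blast
qed

end

lemma near_iff_geodesic_length:
  "geodesic \<Gamma> p x y \<Longrightarrow> near \<Gamma> n x y \<longleftrightarrow> length p \<le> Suc n"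
  unfolding geodesic_iff_near near_def by blast

text \<open>
  A coarsely Lipschitz map with a coarsely Lipschitz coarse right inverse carries hyperbolicity
  over: the images under \<open>f\<close> of the geodesics from \<open>g x\<close> to \<open>g y\<close> are candidates for geodesics,
  and their thinness is that of the triangles in the source. This replaces the stability of
  quasi-geodesics.
\<close>

lemma coarse_inverse_hyperbolic:
  assumes \<Gamma>: "connected_graph \<Gamma>" "hyperbolic_graph \<Gamma>"
    and f: "\<And>a. a \<in> fst \<Gamma> \<Longrightarrow> f a \<in> fst \<Delta>"
    and g: "\<And>y. y \<in> fst \<Delta> \<Longrightarrow> g y \<in> fst \<Gamma>"
    and f_edge: "\<And>a b. a \<in> fst \<Gamma> \<Longrightarrow> b \<in> fst \<Gamma> \<Longrightarrow> {a, b} \<in> snd \<Gamma> \<Longrightarrow> near \<Delta> K (f a) (f b)"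
    and g_edge: "\<And>x y. x \<in> fst \<Delta> \<Longrightarrow> y \<in> fst \<Delta> \<Longrightarrow> {x, y} \<in> snd \<Delta> \<Longrightarrow> near \<Gamma> K (g x) (g y)"
    and fg: "\<And>y. y \<in> fst \<Delta> \<Longrightarrow> near \<Delta> K y (f (g y))"
  shows "connected_graph \<Delta>" "hyperbolic_graph \<Delta>"
proof -
  have f_near: "near \<Delta> (n * K) (f a) (f b)" if "near \<Gamma> n a b" for n a b
    by (rule near_lipschitz[OF that f f_edge])
  have g_near: "near \<Gamma> (n * K) (g x) (g y)" if "near \<Delta> n x y" for n x y
    by (rule near_lipschitz[OF that g g_edge])
  show "connected_graph \<Delta>" unfolding connected_graph_iff_near
  proof (intro ballI)
    fix x y assume xy: "x \<in> fst \<Delta>" "y \<in> fst \<Delta>"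
    then obtain n where "near \<Gamma> n (g x) (g y)"
      using \<Gamma>(1) g unfolding connected_graph_iff_near by blast
    from near_trans[OF near_trans[OF fg[OF xy(1)] f_near[OF this]] near_sym[OF fg[OF xy(2)]]]
    show "\<exists>n. near \<Delta> n x y" by blast
  qed
  obtain \<delta> where \<delta>: "\<And>x y z p q r u. geodesic \<Gamma> p x y \<Longrightarrow> geodesic \<Gamma> q y z \<Longrightarrow> geodesic \<Gamma> r x z
      \<Longrightarrow> u \<in> set p \<Longrightarrow> \<exists>w\<in>set q \<union> set r. near \<Gamma> \<delta> u w"
    using \<Gamma>(2) unfolding hyperbolic_graph_def gdist_le_iff_near by blast
  define geo where "geo a b = (SOME p. geodesic \<Gamma> p a b)" for a b
  have geo: "geodesic \<Gamma> (geo a b) a b" if "a \<in> fst \<Gamma>" "b \<in> fst \<Gamma>" for a b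
    unfolding geo_def using ex_geodesic[OF \<Gamma>(1) that] by (rule someI_ex)
  define L where "L x y = map f (geo (g x) (g y))" for x y
  define D where "D = \<delta> * K + K * K + K"
  have le_D: "K \<le> D" "K * K + K \<le> D" "\<delta> * K \<le> D" unfolding D_def by auto
  have "guessed_geodesics \<Delta> L D"
  proof
    fix x y assume xy: "x \<in> fst \<Delta>" "y \<in> fst \<Delta>"
    let ?p = "geo (g x) (g y)"
    have p: "is_walk \<Gamma> ?p" "hd ?p = g x" "last ?p = g y" "?p \<noteq> []"
      using geo[OF g[OF xy(1)] g[OF xy(2)]] unfolding geodesic_def is_walk_def by auto
    have "successively (\<lambda>a b. near \<Delta> D (f a) (f b)) ?p"
    proof (rule successively_mono)
      show "successively (\<lambda>a b. {a, b} \<in> snd \<Gamma>) ?p" using p(1) unfolding is_walk_def by blast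
      fix a b assume "a \<in> set ?p" "b \<in> set ?p" "{a, b} \<in> snd \<Gamma>"
      then have "near \<Delta> K (f a) (f b)" using p(1) f_edge unfolding is_walk_def by blast
      then show "near \<Delta> D (f a) (f b)" using le_D(1) by (rule near_mono)
    qed
    then show "L x y \<noteq> [] \<and> near \<Delta> D x (hd (L x y)) \<and> near \<Delta> D (last (L x y)) y
        \<and> successively (near \<Delta> D) (L x y)"
      using p fg[OF xy(1)] near_sym[OF fg[OF xy(2)]] le_D(1)
      by (auto simp: L_def hd_map last_map successively_map elim: near_mono)
  next
    fix x y u assume xy: "near \<Delta> 1 x y" and u: "u \<in> set (L x y)"
    have vs: "x \<in> fst \<Delta>" "y \<in> fst \<Delta>" using near_vertices[OF xy] by auto
    note p = geo[OF g[OF vs(1)] g[OF vs(2)]]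
    let ?p = "geo (g x) (g y)"
    have wp: "is_walk \<Gamma> ?p" "hd ?p = g x" "?p \<noteq> []"
      using p unfolding geodesic_def is_walk_def by auto
    have len: "length ?p \<le> Suc K" using near_iff_geodesic_length[OF p] g_near[OF xy] by simp
    obtain i where i: "i < length ?p" "u = f (?p ! i)"
      using u unfolding L_def by (auto simp: in_set_conv_nth)
    have "near \<Gamma> i (g x) (?p ! i)"
      using near_segment[OF wp(1) _ i(1), of 0] wp by (simp add: hd_conv_nth)
    then have "near \<Gamma> K (g x) (?p ! i)" by (rule near_mono) (use i(1) len in linarith)
    from near_trans[OF fg[OF vs(1)] f_near[OF this]] have "near \<Delta> (K + K * K) x u"
      unfolding i(2) .
    then have "near \<Delta> D x u" by (rule near_mono) (use le_D(2) in simp)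
    then show "near \<Delta> D u x" by (rule near_sym)
  next
    fix x y z u assume vs: "x \<in> fst \<Delta>" "y \<in> fst \<Delta>" "z \<in> fst \<Delta>" and u: "u \<in> set (L x y)"
    note gs = g[OF vs(1)] g[OF vs(2)] g[OF vs(3)]
    obtain a where a: "a \<in> set (geo (g x) (g y))" "u = f a" using u unfolding L_def by auto
    obtain b where b: "b \<in> set (rev (geo (g z) (g y))) \<union> set (geo (g x) (g z))" "near \<Gamma> \<delta> a b"
      using \<delta>[OF geo[OF gs(1,2)] geodesic_rev[OF geo[OF gs(3,2)]] geo[OF gs(1,3)] a(1)] by blast
    have "near \<Delta> D u (f b)" using near_mono[OF f_near[OF b(2)] le_D(3)] a(2) by simp
    moreover have "f b \<in> set (L x z) \<union> set (L z y)" using b(1) unfolding L_def by auto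
    ultimately show "\<exists>w\<in>set (L x z) \<union> set (L z y). near \<Delta> D u w" by blast
  qed
  then interpret guessed_geodesics \<Delta> L D .
  show "hyperbolic_graph \<Delta>" by (rule hyperbolic)
qed

section \<open>Coned-off Cayley graphs\<close>

lemma is_walk_delete_vertex:
  "is_walk (delete_vertex \<Gamma> v) p \<longleftrightarrow> is_walk \<Gamma> p \<and> v \<notin> set p"
proof (induction p rule: induct_list012)
  case (3 x y zs) then show ?case by (auto simp: is_walk_def delete_vertex_def)
qed (auto simp: is_walk_def delete_vertex_def)

lemma fst_delete_vertex: "fst (delete_vertex \<Gamma> v) = fst \<Gamma> - {v}"
  by (simp add: delete_vertex_def)

lemma snd_delete_vertex: "{x, y} \<in> snd (delete_vertex \<Gamma> v) \<longleftrightarrow> {x, y} \<in> snd \<Gamma> \<and> x \<noteq> v \<and> y \<noteq> v"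
  by (auto simp: delete_vertex_def)

lemma near_avoiding_walk:
  "is_walk \<Gamma> q \<Longrightarrow> v \<notin> set q \<Longrightarrow> near (delete_vertex \<Gamma> v) (length q) (hd q) (last q)"
  unfolding near_def is_walk_delete_vertex by (intro exI[of _ q]) auto

lemma walk_first_visit:
  assumes q: "is_walk \<Gamma> q" and v: "hd q \<noteq> v" "v \<in> set q"
  shows "\<exists>a\<in>set q. {a, v} \<in> snd \<Gamma> \<and> near (delete_vertex \<Gamma> v) (length q) (hd q) a"
proof -
  obtain ys zs where q_eq: "q = ys @ v # zs" and ys: "v \<notin> set ys"
    using split_list_first[OF v(2)] by blast
  have ne: "ys \<noteq> []" using v(1) q_eq by auto
  have walk: "is_walk \<Gamma> ys" and edge: "{last ys, v} \<in> snd \<Gamma>"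
    using q ne unfolding q_eq is_walk_def by (auto simp: successively_append_iff)
  have "near (delete_vertex \<Gamma> v) (length ys) (hd ys) (last ys)"
    by (rule near_avoiding_walk[OF walk ys])
  then have "near (delete_vertex \<Gamma> v) (length q) (hd q) (last ys)"
    using ne by (auto simp: q_eq elim: near_mono)
  moreover have "last ys \<in> set q" using ne by (simp add: q_eq)
  ultimately show ?thesis using edge by blast
qed

text \<open>
  A walk that meets \<open>v\<close> agrees up to its first and after its last visit with walks that avoid
  \<open>v\<close>; these end, respectively begin, at vertices adjacent to \<open>v\<close> that lie on the given walk.
\<close>

lemma walk_detour:
  assumes q: "is_walk \<Gamma> q" and v: "hd q \<noteq> v" "last q \<noteq> v"
  shows "near (delete_vertex \<Gamma> v) (length q) (hd q) (last q) \<or>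
    (\<exists>a\<in>set q. \<exists>b\<in>set q. {a, v} \<in> snd \<Gamma> \<and> {b, v} \<in> snd \<Gamma> \<and>
      near (delete_vertex \<Gamma> v) (length q) (hd q) a \<and> near (delete_vertex \<Gamma> v) (length q) b (last q))"
proof (cases "v \<in> set q")
  case True
  obtain a where a: "a \<in> set q" "{a, v} \<in> snd \<Gamma>" "near (delete_vertex \<Gamma> v) (length q) (hd q) a"
    using walk_first_visit[OF q v(1) True] by blast
  obtain b where b: "b \<in> set q" "{b, v} \<in> snd \<Gamma>" "near (delete_vertex \<Gamma> v) (length q) (last q) b"
    using walk_first_visit[OF is_walk_rev[OF q], of v] v(2) True by (auto simp: hd_rev)
  show ?thesis using a b near_sym by metis
next
  case False
  then show ?thesis using near_avoiding_walk[OF q] by blast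
qed

lemma left_cosets_iff:
  "C \<in> left_cosets G \<P> \<longleftrightarrow> (\<exists>g\<in>carrier G. \<exists>P\<in>\<P>. C = g <#\<^bsub>G\<^esub> P)"
  unfolding left_cosets_def LCOSETS_def by auto

lemma coned_off_vertex:
  "Inl g \<in> fst (coned_off_Cayley_graph G \<P> S) \<longleftrightarrow> g \<in> carrier G"
  "Inr C \<in> fst (coned_off_Cayley_graph G \<P> S) \<longleftrightarrow> C \<in> left_cosets G \<P>"
  unfolding coned_off_Cayley_graph_def by auto

lemma coned_off_edge:
  "{Inl g, Inl g'} \<in> snd (coned_off_Cayley_graph G \<P> S) \<longleftrightarrow>
     (\<exists>s\<in>S. g \<in> carrier G \<and> g' = g \<otimes>\<^bsub>G\<^esub> s) \<or> (\<exists>s\<in>S. g' \<in> carrier G \<and> g = g' \<otimes>\<^bsub>G\<^esub> s)"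
  "{Inl g, Inr C} \<in> snd (coned_off_Cayley_graph G \<P> S) \<longleftrightarrow> C \<in> left_cosets G \<P> \<and> g \<in> C"
  "{Inr C, Inl g} \<in> snd (coned_off_Cayley_graph G \<P> S) \<longleftrightarrow> C \<in> left_cosets G \<P> \<and> g \<in> C"
  "{Inr C, Inr C'} \<notin> snd (coned_off_Cayley_graph G \<P> S)"
  unfolding coned_off_Cayley_graph_def by (auto simp: doubleton_eq_iff)

text \<open>
  For a symmetric relation it suffices to treat every edge in one orientation.
\<close>

lemma coned_off_edge_cases:
  assumes "{x, y} \<in> snd (coned_off_Cayley_graph G \<P> S)"
    and "\<And>x y. R x y \<Longrightarrow> R y x"
    and "\<And>g s. g \<in> carrier G \<Longrightarrow> s \<in> S \<Longrightarrow> {x, y} = {Inl g, Inl (g \<otimes>\<^bsub>G\<^esub> s)} \<Longrightarrow> R (Inl g) (Inl (g \<otimes>\<^bsub>G\<^esub> s))"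
    and "\<And>g C. C \<in> left_cosets G \<P> \<Longrightarrow> g \<in> C \<Longrightarrow> {x, y} = {Inl g, Inr C} \<Longrightarrow> R (Inl g) (Inr C)"
  shows "R x y"
proof -
  have "(\<exists>g s. g \<in> carrier G \<and> s \<in> S \<and> {x, y} = {Inl g, Inl (g \<otimes>\<^bsub>G\<^esub> s)}) \<or>
    (\<exists>g C. C \<in> left_cosets G \<P> \<and> g \<in> C \<and> {x, y} = {Inl g, Inr C})"
    using assms(1) unfolding coned_off_Cayley_graph_def by auto
  then show ?thesis
  proof (elim disjE exE conjE)
    fix g s assume e: "g \<in> carrier G" "s \<in> S" "{x, y} = {Inl g, Inl (g \<otimes>\<^bsub>G\<^esub> s)}"
    from e assms(3)[OF e] assms(2) show ?thesis by (auto simp: doubleton_eq_iff)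
  next
    fix g C assume e: "C \<in> left_cosets G \<P>" "g \<in> C" "{x, y} = {Inl g, Inr C}"
    from e assms(4)[OF e] assms(2) show ?thesis by (auto simp: doubleton_eq_iff)
  qed
qed

lemma neighbours_cone:
  assumes "C \<in> left_cosets G \<P>" "C \<subseteq> carrier G"
  shows "neighbours (coned_off_Cayley_graph G \<P> S) (Inr C) = Inl ` C"
proof (rule Set.set_eqI)
  fix x show "x \<in> neighbours (coned_off_Cayley_graph G \<P> S) (Inr C) \<longleftrightarrow> x \<in> Inl ` C"
    using assms by (cases x) (auto simp: neighbours_def coned_off_vertex coned_off_edge)
qed

lemma fine_at_cone:
  assumes "C \<in> left_cosets G \<P>" "C \<subseteq> carrier G"
  shows "fine_at (coned_off_Cayley_graph G \<P> S) (Inr C) \<longleftrightarrow>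
    (\<forall>x\<in>C. \<forall>n. finite {y \<in> C. near (delete_vertex (coned_off_Cayley_graph G \<P> S) (Inr C)) n (Inl x) (Inl y)})"
proof -
  let ?\<Delta> = "delete_vertex (coned_off_Cayley_graph G \<P> S) (Inr C)"
  have "{y \<in> Inl ` C. near ?\<Delta> n (Inl x) y} = Inl ` {y \<in> C. near ?\<Delta> n (Inl x) (Inl y)}" for n x
    by auto
  then show ?thesis
    unfolding fine_at_def neighbours_cone[OF assms] angle_metric_def gdist_le_iff_near
    by (simp add: finite_image_iff)
qed

context group begin

lemma left_coset_subset:
  assumes "C \<in> left_cosets G \<P>" "\<And>P. P \<in> \<P> \<Longrightarrow> subgroup P G"
  shows "C \<subseteq> carrier G"
  using assms l_coset_subset_G subgroup.subset unfolding left_cosets_iff by metis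

lemma left_coset_translate:
  assumes "C \<in> left_cosets G \<P>" "\<And>P. P \<in> \<P> \<Longrightarrow> subgroup P G" "h \<in> carrier G"
  shows "h <# C \<in> left_cosets G \<P>"
proof -
  obtain g P where C: "g \<in> carrier G" "P \<in> \<P>" "C = g <# P" using assms(1) unfolding left_cosets_iff by blast
  then have "h <# C = (h \<otimes> g) <# P" using assms lcos_m_assoc subgroup.subset by metis
  then show ?thesis using C assms(3) unfolding left_cosets_iff by blast
qed

definition translate :: "'a \<Rightarrow> 'a + 'a set \<Rightarrow> 'a + 'a set" where
  "translate h = map_sum (\<lambda>g. h \<otimes> g) (\<lambda>C. h <# C)"

lemma translate_simps [simp]:
  "translate h (Inl g) = Inl (h \<otimes> g)" "translate h (Inr C) = Inr (h <# C)"
  by (simp_all add: translate_def)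

lemma l_coset_mem: "g \<in> C \<Longrightarrow> h \<otimes> g \<in> h <# C"
  by (auto simp: l_coset_def)

lemma translate_vertex:
  assumes "\<And>P. P \<in> \<P> \<Longrightarrow> subgroup P G" "h \<in> carrier G" "x \<in> fst (coned_off_Cayley_graph G \<P> S)"
  shows "translate h x \<in> fst (coned_off_Cayley_graph G \<P> S)"
  using assms by (cases x) (auto simp: coned_off_vertex left_coset_translate)

lemma translate_edge:
  assumes sub: "\<And>P. P \<in> \<P> \<Longrightarrow> subgroup P G" and S: "S \<subseteq> carrier G" and h: "h \<in> carrier G"
    and e: "{x, y} \<in> snd (coned_off_Cayley_graph G \<P> S)"
  shows "{translate h x, translate h y} \<in> snd (coned_off_Cayley_graph G \<P> S)"
  using e
proof (rule coned_off_edge_cases)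
  fix g s assume "g \<in> carrier G" "s \<in> S"
  then show "{translate h (Inl g), translate h (Inl (g \<otimes> s))} \<in> snd (coned_off_Cayley_graph G \<P> S)"
    using h S by (auto simp: coned_off_edge m_assoc[symmetric] subset_iff)
next
  fix g C assume "C \<in> left_cosets G \<P>" "g \<in> C"
  then show "{translate h (Inl g), translate h (Inr C)} \<in> snd (coned_off_Cayley_graph G \<P> S)"
    using left_coset_translate[OF _ sub h] l_coset_mem by (auto simp: coned_off_edge)
qed (simp add: insert_commute)

lemma is_walk_translate:
  assumes sub: "\<And>P. P \<in> \<P> \<Longrightarrow> subgroup P G" and S: "S \<subseteq> carrier G" and h: "h \<in> carrier G"
    and p: "is_walk (coned_off_Cayley_graph G \<P> S) p"
  shows "is_walk (coned_off_Cayley_graph G \<P> S) (map (translate h) p)"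
proof -
  have "successively (\<lambda>x y. {translate h x, translate h y} \<in> snd (coned_off_Cayley_graph G \<P> S)) p"
    by (rule successively_mono[of "\<lambda>x y. {x, y} \<in> snd (coned_off_Cayley_graph G \<P> S)"])
      (use p translate_edge[OF sub S h] in \<open>auto simp: is_walk_def\<close>)
  then show ?thesis
    using p translate_vertex[OF sub h] unfolding is_walk_def by (auto simp: successively_map)
qed

lemma near_translate:
  assumes sub: "\<And>P. P \<in> \<P> \<Longrightarrow> subgroup P G" and S: "S \<subseteq> carrier G" and h: "h \<in> carrier G"
    and p: "near (coned_off_Cayley_graph G \<P> S) n x y"
  shows "near (coned_off_Cayley_graph G \<P> S) n (translate h x) (translate h y)"
proof -
  obtain p where p: "is_walk (coned_off_Cayley_graph G \<P> S) p" "hd p = x" "last p = y" "length p \<le> Suc n"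
    using p unfolding near_def by blast
  moreover from this have "p \<noteq> []" unfolding is_walk_def by blast
  ultimately show ?thesis using is_walk_translate[OF sub S h p(1)] unfolding near_def
    by (intro exI[of _ "map (translate h) p"]) (simp add: hd_map last_map)
qed

end

section \<open>Finite enlargements of the relative generating set\<close>

context group begin

text \<open>
  An edge from \<open>g\<close> to \<open>g c\<close> is replaced by the translate \<open>g \<gamma>\<close> of one fixed walk \<open>\<gamma>\<close> from \<open>1\<close> to
  \<open>c\<close>. The translate may run through the cone vertex that is to be avoided. It then first enters and
  last leaves this vertex through elements \<open>g a\<close> and \<open>g b\<close> of the coset with \<open>a\<close> and \<open>b\<close> on \<open>\<gamma>\<close>, so the
  quotient of the two lies in the finite set \<open>J\<close> of all \<open>a\<inverse> b\<close>. Hence each new edge adds, for every element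
  of the coset, only finitely many elements that are reached by a jump through the cone vertex.
\<close>

lemma add_generator_fine:
  assumes sub: "\<And>P. P \<in> \<P> \<Longrightarrow> subgroup P G" and T: "T \<subseteq> carrier G" and c: "c \<in> carrier G"
    and conn: "connected_graph (coned_off_Cayley_graph G \<P> T)"
    and fine: "fine_at (coned_off_Cayley_graph G \<P> T) (Inr C)" and C: "C \<in> left_cosets G \<P>"
  shows "fine_at (coned_off_Cayley_graph G \<P> (insert c T)) (Inr C)"
proof -
  let ?\<Gamma> = "coned_off_Cayley_graph G \<P> T" and ?\<Gamma>' = "coned_off_Cayley_graph G \<P> (insert c T)"
  define \<Delta> \<Delta>' where "\<Delta> = delete_vertex ?\<Gamma> (Inr C)" and "\<Delta>' = delete_vertex ?\<Gamma>' (Inr C)"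
  have CG: "C \<subseteq> carrier G" by (rule left_coset_subset[OF C sub])
  have ball: "finite {y \<in> C. near \<Delta> n (Inl x) (Inl y)}" if "x \<in> C" for x n
    using fine that unfolding fine_at_cone[OF C CG] \<Delta>_def by blast
  have vertices: "fst \<Delta>' = fst \<Delta>"
    unfolding \<Delta>_def \<Delta>'_def fst_delete_vertex coned_off_Cayley_graph_def by simp
  obtain \<gamma> where \<gamma>: "is_walk ?\<Gamma> \<gamma>" "hd \<gamma> = Inl \<one>" "last \<gamma> = Inl c"
    using conn c unfolding connected_graph_def by (metis coned_off_vertex(1) one_closed)
  have \<gamma>_ne: "\<gamma> \<noteq> []" using \<gamma>(1) unfolding is_walk_def by blast
  define N where "N = length \<gamma>"
  define E where "E = {g. Inl g \<in> set \<gamma>}"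
  define J where "J = (\<lambda>(a, b). inv a \<otimes> b) ` (E \<times> E)"
  have "Inl ` E \<subseteq> set \<gamma>" unfolding E_def by auto
  then have "finite E" by (rule finite_subset[THEN finite_imageD]) auto
  then have "finite J" unfolding J_def by simp
  have EG: "E \<subseteq> carrier G" using \<gamma>(1) unfolding E_def is_walk_def
    by (auto simp: subset_iff coned_off_vertex)
  define step where "step y z \<longleftrightarrow> near \<Delta> (Suc N) y z \<or>
      (\<exists>a\<in>C. \<exists>b\<in>C. inv a \<otimes> b \<in> J \<and> near \<Delta> (Suc N) y (Inl a) \<and> near \<Delta> (Suc N) (Inl b) z)" for y z
  have inv_J: "inv b \<otimes> a \<in> J" if "inv a \<otimes> b \<in> J" "a \<in> C" "b \<in> C" for a b
  proof -
    obtain a0 b0 where ab: "a0 \<in> E" "b0 \<in> E" "inv a \<otimes> b = inv a0 \<otimes> b0"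
      using \<open>inv a \<otimes> b \<in> J\<close> unfolding J_def by auto
    have "inv b \<otimes> a = inv (inv a \<otimes> b)" using that(2,3) CG by (simp add: inv_mult_group subset_iff)
    also have "\<dots> = inv b0 \<otimes> a0" unfolding ab(3) using ab(1,2) EG by (simp add: inv_mult_group subset_iff)
    finally show ?thesis unfolding J_def using ab(1,2) by force
  qed
  have step_sym: "step z y" if "step y z" for y z
    using that unfolding step_def using inv_J near_sym by metis
  have new_edge: "step (Inl g) (Inl (g \<otimes> c))" if g: "g \<in> carrier G" for g
  proof -
    let ?q = "map (translate g) \<gamma>"
    have q: "is_walk ?\<Gamma> ?q" "hd ?q = Inl g" "last ?q = Inl (g \<otimes> c)" "length ?q = N"
      using is_walk_translate[OF sub T g \<gamma>(1)] \<gamma> \<gamma>_ne g by (auto simp: hd_map last_map N_def)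
    have on_q: "\<exists>a0\<in>E. x = Inl (g \<otimes> a0) \<and> g \<otimes> a0 \<in> C" if "x \<in> set ?q" "{x, Inr C} \<in> snd ?\<Gamma>" for x
    proof -
      obtain y where y: "y \<in> set \<gamma>" "x = translate g y" using \<open>x \<in> set ?q\<close> by auto
      have e: "{translate g y, Inr C} \<in> snd ?\<Gamma>" using that(2) y(2) by simp
      show ?thesis by (cases y) (use y e in \<open>auto simp: coned_off_edge E_def\<close>)
    qed
    have "near \<Delta> N (Inl g) (Inl (g \<otimes> c)) \<or> (\<exists>x\<in>set ?q. \<exists>y\<in>set ?q. {x, Inr C} \<in> snd ?\<Gamma> \<and> {y, Inr C} \<in> snd ?\<Gamma>
        \<and> near \<Delta> N (Inl g) x \<and> near \<Delta> N y (Inl (g \<otimes> c)))"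
      using walk_detour[OF q(1), of "Inr C"] unfolding q(2-4) \<Delta>_def by simp
    then show ?thesis
    proof (elim disjE bexE conjE)
      assume "near \<Delta> N (Inl g) (Inl (g \<otimes> c))"
      then show ?thesis unfolding step_def by (auto elim: near_mono)
    next
      fix x y assume xy: "x \<in> set ?q" "y \<in> set ?q" "{x, Inr C} \<in> snd ?\<Gamma>" "{y, Inr C} \<in> snd ?\<Gamma>"
        "near \<Delta> N (Inl g) x" "near \<Delta> N y (Inl (g \<otimes> c))"
      obtain a0 where a0: "a0 \<in> E" "x = Inl (g \<otimes> a0)" "g \<otimes> a0 \<in> C" using on_q xy by blast
      obtain b0 where b0: "b0 \<in> E" "y = Inl (g \<otimes> b0)" "g \<otimes> b0 \<in> C" using on_q xy by blast
      have "inv (g \<otimes> a0) \<otimes> (g \<otimes> b0) = inv a0 \<otimes> b0"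
        using g a0(1) b0(1) EG by (simp add: inv_mult_group m_assoc subset_iff inv_solve_left')
      then have "inv (g \<otimes> a0) \<otimes> (g \<otimes> b0) \<in> J" using a0(1) b0(1) unfolding J_def by force
      moreover have "near \<Delta> (Suc N) (Inl g) (Inl (g \<otimes> a0))" "near \<Delta> (Suc N) (Inl (g \<otimes> b0)) (Inl (g \<otimes> c))"
        using xy(5,6) a0(2) b0(2) by (auto elim: near_mono)
      ultimately show ?thesis unfolding step_def using a0(3) b0(3) by blast
    qed
  qed
  have edge_step: "step y z" if yz: "{y, z} \<in> snd \<Delta>'" "y \<in> fst \<Delta>'" "z \<in> fst \<Delta>'" for y z
  proof -
    have e: "{y, z} \<in> snd ?\<Gamma>'" and ne: "y \<noteq> Inr C" "z \<noteq> Inr C"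
      using yz(1) unfolding \<Delta>'_def snd_delete_vertex by auto
    have old: "step y z" if "{y, z} \<in> snd ?\<Gamma>"
    proof -
      have "{y, z} \<in> snd \<Delta>" using that ne unfolding \<Delta>_def snd_delete_vertex by simp
      then have "near \<Delta> 1 y z" using near_edge yz(2,3) vertices by metis
      then show ?thesis unfolding step_def by (auto elim: near_mono)
    qed
    have "{y, z} \<in> snd ?\<Gamma> \<or> (\<exists>g\<in>carrier G. {y, z} = {Inl g, Inl (g \<otimes> c)})"
      using e unfolding coned_off_Cayley_graph_def by auto
    then show ?thesis using old new_edge step_sym by (auto simp: doubleton_eq_iff)
  qed
  \<comment> \<open>\<open>A\<close> consists of the start and of the elements of \<open>C\<close> at which jumps through the cone vertex
    end; from these on, the walk avoids the cone vertex in the original graph.\<close>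
  have reach: "\<exists>A m. finite A \<and> A \<subseteq> C \<and> (\<forall>z. near \<Delta>' n (Inl x) z \<longrightarrow> (\<exists>a\<in>A. near \<Delta> m (Inl a) z))"
    if x: "x \<in> C" for x n
  proof (induction n)
    case 0
    show ?case using x vertices
      by (intro exI[of _ "{x}"] exI[of _ 0]) (auto simp: near_0)
  next
    case (Suc n)
    then obtain A m where A: "finite A" "A \<subseteq> C"
      "\<And>z. near \<Delta>' n (Inl x) z \<Longrightarrow> \<exists>a\<in>A. near \<Delta> m (Inl a) z" by blast
    define B where "B = (\<Union>a\<in>A. {a' \<in> C. near \<Delta> (m + Suc N) (Inl a) (Inl a')})"
    define A' where "A' = A \<union> ((\<lambda>(a', j). a' \<otimes> j) ` (B \<times> J) \<inter> C)"
    have "finite B" unfolding B_def using A(1,2) ball by auto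
    then have "finite A'" unfolding A'_def using A(1) \<open>finite J\<close> by simp
    moreover have "A' \<subseteq> C" unfolding A'_def using A(2) by blast
    moreover have "\<exists>a\<in>A'. near \<Delta> (m + Suc N) (Inl a) z" if "near \<Delta>' (Suc n) (Inl x) z" for z
    proof -
      from that consider "near \<Delta>' n (Inl x) z"
        | y where "near \<Delta>' n (Inl x) y" "z \<in> fst \<Delta>'" "{y, z} \<in> snd \<Delta>'"
        by (auto simp: near_Suc)
      then show ?thesis
      proof cases
        case 1
        then obtain a where "a \<in> A" "near \<Delta> m (Inl a) z" using A(3) by blast
        then show ?thesis unfolding A'_def by (auto intro!: bexI[of _ a] elim: near_mono)
      next
        case 2
        obtain a where a: "a \<in> A" "near \<Delta> m (Inl a) y" using A(3) 2(1) by blast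
        have "step y z" using edge_step 2 near_vertices[OF 2(1)] by blast
        then consider "near \<Delta> (Suc N) y z" | a' b' where "a' \<in> C" "b' \<in> C" "inv a' \<otimes> b' \<in> J"
          "near \<Delta> (Suc N) y (Inl a')" "near \<Delta> (Suc N) (Inl b') z" unfolding step_def by blast
        then show ?thesis
        proof cases
          case 1
          from near_trans[OF a(2) this] show ?thesis using a(1) unfolding A'_def by blast
        next
          case (2 a' b')
          have "a' \<in> B" unfolding B_def using near_trans[OF a(2) 2(4)] a(1) 2(1) by blast
          moreover have "b' = a' \<otimes> (inv a' \<otimes> b')"
            using 2(1,2) CG by (simp add: m_assoc[symmetric] subset_iff)
          ultimately have "b' \<in> A'" unfolding A'_def using 2(2,3) by force
          moreover have "near \<Delta> (m + Suc N) (Inl b') z" by (rule near_mono[OF 2(5)]) simp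
          ultimately show ?thesis by blast
        qed
      qed
    qed
    ultimately show ?case by blast
  qed
  have "finite {y \<in> C. near \<Delta>' n (Inl x) (Inl y)}" if "x \<in> C" for x n
  proof -
    obtain A m where A: "finite A" "A \<subseteq> C" "\<And>z. near \<Delta>' n (Inl x) z \<Longrightarrow> \<exists>a\<in>A. near \<Delta> m (Inl a) z"
      using reach[OF \<open>x \<in> C\<close>, of n] by blast
    have "{y \<in> C. near \<Delta>' n (Inl x) (Inl y)} \<subseteq> (\<Union>a\<in>A. {y \<in> C. near \<Delta> m (Inl a) (Inl y)})"
      using A(3) by blast
    moreover have "finite (\<Union>a\<in>A. {y \<in> C. near \<Delta> m (Inl a) (Inl y)})" using A(1,2) ball by auto
    ultimately show ?thesis by (rule finite_subset)
  qed
  then show ?thesis unfolding fine_at_cone[OF C CG] \<Delta>'_def by blast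
qed

lemma hyp_embedded_wrt_iff:
  "hyp_embedded_wrt G \<P> S \<longleftrightarrow> (\<forall>P\<in>\<P>. subgroup P G \<and> infinite P) \<and> S \<subseteq> carrier G \<and>
     connected_graph (coned_off_Cayley_graph G \<P> S) \<and> hyperbolic_graph (coned_off_Cayley_graph G \<P> S) \<and>
     (\<forall>C\<in>left_cosets G \<P>. fine_at (coned_off_Cayley_graph G \<P> S) (Inr C))"
  unfolding hyp_embedded_wrt_def Let_def by blast

text \<open>
  The two coned-off graphs have the same vertices, and the identity is coarsely Lipschitz in both
  directions.
\<close>

lemma hyp_embedded_wrt_insert:
  assumes hyp: "hyp_embedded_wrt G \<P> T" and c: "c \<in> carrier G"
  shows "hyp_embedded_wrt G \<P> (insert c T)"
proof -
  let ?\<Gamma> = "coned_off_Cayley_graph G \<P> T" and ?\<Gamma>' = "coned_off_Cayley_graph G \<P> (insert c T)"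
  have sub: "\<And>P. P \<in> \<P> \<Longrightarrow> subgroup P G" and T: "T \<subseteq> carrier G"
    and conn: "connected_graph ?\<Gamma>" and hyperb: "hyperbolic_graph ?\<Gamma>"
    and fine: "\<And>C. C \<in> left_cosets G \<P> \<Longrightarrow> fine_at ?\<Gamma> (Inr C)"
    using hyp unfolding hyp_embedded_wrt_iff by blast+
  have vertices: "fst ?\<Gamma>' = fst ?\<Gamma>" unfolding coned_off_Cayley_graph_def by simp
  obtain N where N: "near ?\<Gamma> N (Inl \<one>) (Inl c)"
    using conn c unfolding connected_graph_iff_near by (metis coned_off_vertex(1) one_closed)
  have old: "near ?\<Gamma>' (Suc N) x y"
    if "x \<in> fst ?\<Gamma>" "y \<in> fst ?\<Gamma>" "{x, y} \<in> snd ?\<Gamma>" for x y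
  proof -
    have "{x, y} \<in> snd ?\<Gamma>'" using that(3) unfolding coned_off_Cayley_graph_def by auto
    then have "near ?\<Gamma>' 1 x y" using near_edge that(1,2) vertices by metis
    then show ?thesis by (rule near_mono) simp
  qed
  have new: "near ?\<Gamma> (Suc N) x y"
    if xy: "x \<in> fst ?\<Gamma>'" "y \<in> fst ?\<Gamma>'" "{x, y} \<in> snd ?\<Gamma>'" for x y
  proof -
    have *: "near ?\<Gamma> (Suc N) (Inl g) (Inl (g \<otimes> c))" if "g \<in> carrier G" for g
      using near_mono[OF near_translate[OF sub T that N], of "Suc N"] that c by simp
    have "{x, y} \<in> snd ?\<Gamma> \<or> (\<exists>g\<in>carrier G. {x, y} = {Inl g, Inl (g \<otimes> c)})"
      using xy(3) unfolding coned_off_Cayley_graph_def by auto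
    then show ?thesis
    proof
      assume "{x, y} \<in> snd ?\<Gamma>"
      then have "near ?\<Gamma> 1 x y" using near_edge xy(1,2) vertices by metis
      then show ?thesis by (rule near_mono) simp
    qed (use * near_sym[OF *] in \<open>auto simp: doubleton_eq_iff\<close>)
  qed
  have fixed: "near ?\<Gamma>' (Suc N) y y" if "y \<in> fst ?\<Gamma>'" for y
    by (rule near_refl[OF that])
  have ids: "\<And>y. y \<in> fst ?\<Gamma> \<Longrightarrow> y \<in> fst ?\<Gamma>'" "\<And>y. y \<in> fst ?\<Gamma>' \<Longrightarrow> y \<in> fst ?\<Gamma>"
    by (simp_all only: vertices)
  note coarse_inverse_hyperbolic[OF conn hyperb, of "\<lambda>x. x" ?\<Gamma>' "\<lambda>x. x", OF ids old new fixed]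
  moreover have "fine_at ?\<Gamma>' (Inr C)" if "C \<in> left_cosets G \<P>" for C
    by (rule add_generator_fine[OF sub T c conn fine[OF that] that])
  ultimately show ?thesis using hyp c unfolding hyp_embedded_wrt_iff by blast
qed

lemma hyp_embedded_wrt_union_finite:
  assumes "hyp_embedded_wrt G \<P> T" "finite F" "F \<subseteq> carrier G"
  shows "hyp_embedded_wrt G \<P> (T \<union> F)"
  using assms(2,3,1) by (induction F) (auto intro: hyp_embedded_wrt_insert)

text \<open>
  This is almost malnormality of the collection, phrased in terms of cosets. If infinitely many
  \<open>k\<close> fix two different cone vertices \<open>C\<close> and \<open>C'\<close>, let \<open>g\<close> be the element of \<open>C\<close> through which a walk
  from \<open>C'\<close> first reaches \<open>C\<close>. The infinitely many elements \<open>k g\<close> of \<open>C\<close> are at bounded distance from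
  \<open>C'\<close> in the complement of \<open>C\<close>, which contradicts fineness at \<open>C\<close>.
\<close>

lemma infinite_stabilizer_unique_cone:
  assumes hyp: "hyp_embedded_wrt G \<P> T" and C: "C \<in> left_cosets G \<P>" "C' \<in> left_cosets G \<P>"
    and inf: "infinite {k \<in> carrier G. k <# C = C \<and> k <# C' = C'}"
  shows "C = C'"
proof (rule ccontr)
  assume "C \<noteq> C'"
  let ?\<Gamma> = "coned_off_Cayley_graph G \<P> T" and ?K = "{k \<in> carrier G. k <# C = C \<and> k <# C' = C'}"
  let ?\<Delta> = "delete_vertex ?\<Gamma> (Inr C)"
  have sub: "\<And>P. P \<in> \<P> \<Longrightarrow> subgroup P G" and T: "T \<subseteq> carrier G"
    and conn: "connected_graph ?\<Gamma>" and fine: "fine_at ?\<Gamma> (Inr C)"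
    using hyp C(1) unfolding hyp_embedded_wrt_iff by blast+
  have CG: "C \<subseteq> carrier G" by (rule left_coset_subset[OF C(1) sub])
  obtain p where p: "is_walk ?\<Gamma> p" "hd p = Inr C'" "last p = Inr C"
    using conn C unfolding connected_graph_def by (metis coned_off_vertex(2))
  then have "Inr C \<in> set p" unfolding is_walk_def by (metis last_in_set)
  then obtain x where x: "{x, Inr C} \<in> snd ?\<Gamma>" "near ?\<Delta> (length p) (Inr C') x"
    using walk_first_visit[OF p(1), of "Inr C"] p(2) \<open>C \<noteq> C'\<close> by auto
  then obtain g where g: "x = Inl g" "g \<in> C" by (cases x) (auto simp: coned_off_edge)
  let ?n = "length p"
  have tr: "near ?\<Delta> ?n (Inr C') (Inl (k \<otimes> g))" if k: "k \<in> ?K" for k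
  proof -
    have tv: "translate k y \<in> fst ?\<Delta>" if y: "y \<in> fst ?\<Delta>" for y
    proof -
      have "translate k y \<noteq> Inr C"
      proof
        assume eq: "translate k y = Inr C"
        then obtain C1 where C1: "y = Inr C1" "k <# C1 = k <# C" using k by (cases y) auto
        have "C1 \<subseteq> carrier G" using y C1 left_coset_subset[OF _ sub]
          by (auto simp: fst_delete_vertex coned_off_vertex)
        moreover have "inv k <# (k <# B) = B" if "B \<subseteq> carrier G" for B
          using k that by (simp add: lcos_m_assoc lcos_mult_one)
        ultimately have "C1 = C" using C1(2) CG by metis
        then show False using y C1 by (simp add: fst_delete_vertex)
      qed
      then show ?thesis using y translate_vertex[OF sub, where h=k and x=y] k by (auto simp: fst_delete_vertex)
    qed
    have "near ?\<Delta> (?n * 1) (translate k (Inr C')) (translate k (Inl g))"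
    proof (rule near_lipschitz[OF _ tv])
      show "near ?\<Delta> ?n (Inr C') (Inl g)" using x g by simp
      fix a b assume ab: "a \<in> fst ?\<Delta>" "b \<in> fst ?\<Delta>" "{a, b} \<in> snd ?\<Delta>"
      have "{translate k a, translate k b} \<in> snd ?\<Gamma>"
        using translate_edge[OF sub T, where h=k and x=a and y=b] k ab(3) by (simp add: snd_delete_vertex)
      moreover have "translate k a \<in> fst ?\<Delta>" "translate k b \<in> fst ?\<Delta>" using tv ab(1,2) by blast+
      ultimately show "near ?\<Delta> 1 (translate k a) (translate k b)"
        by (intro near_edge) (auto simp: snd_delete_vertex fst_delete_vertex)
    qed
    then show ?thesis using k by simp
  qed
  have "(\<lambda>k. k \<otimes> g) ` ?K \<subseteq> {y \<in> C. near ?\<Delta> (?n + ?n) (Inl g) (Inl y)}"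
  proof (intro image_subsetI CollectI conjI)
    fix k assume k: "k \<in> ?K"
    show "k \<otimes> g \<in> C" using l_coset_mem[OF g(2), of k] k by simp
    show "near ?\<Delta> (?n + ?n) (Inl g) (Inl (k \<otimes> g))"
      using near_trans[OF near_sym[OF x(2)] tr[OF k]] g(1) by simp
  qed
  moreover have "finite {y \<in> C. near ?\<Delta> (?n + ?n) (Inl g) (Inl y)}"
    using fine g(2) unfolding fine_at_cone[OF C(1) CG] by blast
  ultimately have "finite ((\<lambda>k. k \<otimes> g) ` ?K)" by (rule finite_subset)
  moreover have "inj_on (\<lambda>k. k \<otimes> g) ?K" using g(2) CG by (auto intro!: inj_onI)
  ultimately have "finite ?K" by (rule finite_imageD)
  with inf show False by blast
qed

end

section \<open>Conjugates, normalizers and stabilizers of cosets\<close>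

context group begin

lemma mult_inv_cancel:
  assumes "g \<in> carrier G" "x \<in> carrier G"
  shows "inv g \<otimes> (g \<otimes> x) = x" "g \<otimes> (inv g \<otimes> x) = x"
  using assms by (simp_all add: m_assoc[symmetric])

lemma conj_set_iff:
  assumes "A \<subseteq> carrier G" "g \<in> carrier G"
  shows "x \<in> conj_set G g A \<longleftrightarrow> x \<in> carrier G \<and> inv g \<otimes> x \<otimes> g \<in> A"
proof -
  have "x \<in> conj_set G g A \<longleftrightarrow> (\<exists>a\<in>A. x = g \<otimes> a \<otimes> inv g)"
    unfolding conj_set_def l_coset_def r_coset_def by auto
  also have "\<dots> \<longleftrightarrow> x \<in> carrier G \<and> inv g \<otimes> x \<otimes> g \<in> A"
  proof
    assume "\<exists>a\<in>A. x = g \<otimes> a \<otimes> inv g"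
    then obtain a where a: "a \<in> A" "x = g \<otimes> a \<otimes> inv g" by blast
    moreover have "a \<in> carrier G" using a assms by blast
    ultimately show "x \<in> carrier G \<and> inv g \<otimes> x \<otimes> g \<in> A"
      using assms(2) by (simp add: m_assoc mult_inv_cancel)
  next
    assume x: "x \<in> carrier G \<and> inv g \<otimes> x \<otimes> g \<in> A"
    then have "x = g \<otimes> (inv g \<otimes> x \<otimes> g) \<otimes> inv g" using assms(2)
      by (simp add: m_assoc mult_inv_cancel)
    then show "\<exists>a\<in>A. x = g \<otimes> a \<otimes> inv g" using x by blast
  qed
  finally show ?thesis .
qed

lemma conj_set_subset: "A \<subseteq> carrier G \<Longrightarrow> g \<in> carrier G \<Longrightarrow> conj_set G g A \<subseteq> carrier G"
  using conj_set_iff by blast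

lemma conj_set_mult:
  assumes "A \<subseteq> carrier G" "g \<in> carrier G" "h \<in> carrier G"
  shows "conj_set G g (conj_set G h A) = conj_set G (g \<otimes> h) A"
proof (rule Set.set_eqI)
  fix x
  show "x \<in> conj_set G g (conj_set G h A) \<longleftrightarrow> x \<in> conj_set G (g \<otimes> h) A"
    using assms by (auto simp: conj_set_iff conj_set_subset inv_mult_group m_assoc)
qed

lemma conj_set_one: "A \<subseteq> carrier G \<Longrightarrow> conj_set G \<one> A = A"
  by (auto simp: conj_set_iff subset_iff)

lemma conj_set_cancel:
  assumes "A \<subseteq> carrier G" "g \<in> carrier G"
  shows "conj_set G (inv g) (conj_set G g A) = A"
  using assms by (simp add: conj_set_mult conj_set_one)

lemma conj_set_Int:
  assumes "A \<subseteq> carrier G" "B \<subseteq> carrier G" "g \<in> carrier G"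
  shows "conj_set G g (A \<inter> B) = conj_set G g A \<inter> conj_set G g B"
  using assms by (auto simp: conj_set_iff subset_iff le_infI1)

lemma conj_set_subgroup:
  assumes "subgroup A G" "g \<in> carrier G"
  shows "subgroup (conj_set G g A) G"
proof -
  interpret A: subgroup A G by fact
  note iff = conj_set_iff[OF A.subset assms(2)]
  show ?thesis
  proof (rule subgroupI)
    show "conj_set G g A \<subseteq> carrier G" using iff by blast
    have "\<one> \<in> conj_set G g A" unfolding iff using assms(2) by simp
    then show "conj_set G g A \<noteq> {}" by blast
    fix x assume x: "x \<in> conj_set G g A"
    have "inv g \<otimes> inv x \<otimes> g = inv (inv g \<otimes> x \<otimes> g)"
      using x assms(2) unfolding iff by (simp add: inv_mult_group m_assoc)
    then show "inv x \<in> conj_set G g A" using x A.m_inv_closed unfolding iff by simp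
    fix y assume y: "y \<in> conj_set G g A"
    have "inv g \<otimes> (x \<otimes> y) \<otimes> g = (inv g \<otimes> x \<otimes> g) \<otimes> (inv g \<otimes> y \<otimes> g)"
      using x y assms(2) unfolding iff by (simp add: m_assoc mult_inv_cancel)
    then show "x \<otimes> y \<in> conj_set G g A" using x y A.m_closed unfolding iff by simp
  qed
qed

lemma conj_set_infinite:
  assumes "A \<subseteq> carrier G" "g \<in> carrier G" "infinite A"
  shows "infinite (conj_set G g A)"
proof
  assume "finite (conj_set G g A)"
  moreover have "A \<subseteq> (\<lambda>x. inv g \<otimes> x \<otimes> g) ` conj_set G g A"
  proof
    fix a assume a: "a \<in> A"
    then have "a \<in> conj_set G (inv g) (conj_set G g A)" by (simp only: conj_set_cancel[OF assms(1,2)])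
    then show "a \<in> (\<lambda>x. inv g \<otimes> x \<otimes> g) ` conj_set G g A"
      unfolding conj_set_def[of G "inv g"] l_coset_def r_coset_def using assms(2) by auto
  qed
  ultimately show False using assms(3) finite_surj by blast
qed

lemma normalizer_iff:
  assumes "A \<subseteq> carrier G"
  shows "g \<in> normalizer G A \<longleftrightarrow> g \<in> carrier G \<and> conj_set G g A = A"
  using assms unfolding normalizer_def stabilizer_def conj_set_def by simp

lemma normalizer_conj_set:
  assumes A: "A \<subseteq> carrier G" and g: "g \<in> carrier G"
  shows "normalizer G (conj_set G g A) = conj_set G g (normalizer G A)"
proof (rule Set.set_eqI)
  fix x
  have sub: "normalizer G A \<subseteq> carrier G" using normalizer_iff[OF A] by blast
  have "conj_set G x (conj_set G g A) = conj_set G g A \<longleftrightarrow> conj_set G (inv g \<otimes> x \<otimes> g) A = A"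
    if x: "x \<in> carrier G"
  proof
    assume "conj_set G x (conj_set G g A) = conj_set G g A"
    then have "conj_set G (inv g) (conj_set G x (conj_set G g A)) = A"
      using conj_set_cancel[OF A g] by simp
    then show "conj_set G (inv g \<otimes> x \<otimes> g) A = A"
      using A g x by (simp add: conj_set_mult m_assoc conj_set_subset)
  next
    assume "conj_set G (inv g \<otimes> x \<otimes> g) A = A"
    then have "conj_set G g (conj_set G (inv g \<otimes> x \<otimes> g) A) = conj_set G g A" by simp
    then show "conj_set G x (conj_set G g A) = conj_set G g A"
      using A g x by (simp add: conj_set_mult m_assoc mult_inv_cancel)
  qed
  then show "x \<in> normalizer G (conj_set G g A) \<longleftrightarrow> x \<in> conj_set G g (normalizer G A)"
    unfolding conj_set_iff[OF sub g] normalizer_iff[OF A] normalizer_iff[OF conj_set_subset[OF A g]]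
    using g by auto
qed

text \<open>
  The stabilizer of the coset \<open>g P\<close> under left multiplication is \<open>g P g\<inverse>\<close>; this links cone vertices
  with conjugates.
\<close>

definition coset_stabilizer :: "'a set \<Rightarrow> 'a set" where
  "coset_stabilizer C = {k \<in> carrier G. k <# C = C}"

lemma coset_stabilizer_coset:
  assumes P: "subgroup P G" and g: "g \<in> carrier G"
  shows "coset_stabilizer (g <# P) = conj_set G g P"
proof (rule Set.set_eqI)
  fix k
  interpret P: subgroup P G by fact
  have "k <# (g <# P) = g <# P \<longleftrightarrow> inv g \<otimes> k \<otimes> g \<in> P" if k: "k \<in> carrier G"
  proof
    assume "k <# (g <# P) = g <# P"
    then have "k \<otimes> g \<in> g <# P"
      using lcos_self[OF g P] l_coset_mem[of g "g <# P" k] by simp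
    then show "inv g \<otimes> k \<otimes> g \<in> P" using P.lcos_module_imp[OF group_axioms g] k g by (simp add: m_assoc)
  next
    assume "inv g \<otimes> k \<otimes> g \<in> P"
    then have "inv g \<otimes> k \<otimes> g <# P = P" using coset_join3[OF _ P] k g by simp
    then have "g <# (inv g \<otimes> k \<otimes> g <# P) = g <# P" by simp
    then show "k <# (g <# P) = g <# P"
      using k g P.subset by (simp add: lcos_m_assoc m_assoc mult_inv_cancel)
  qed
  then show "k \<in> coset_stabilizer (g <# P) \<longleftrightarrow> k \<in> conj_set G g P"
    unfolding coset_stabilizer_def conj_set_iff[OF P.subset g] by auto
qed

lemma coset_stabilizer_translate:
  assumes "C \<subseteq> carrier G" "h \<in> carrier G"
  shows "coset_stabilizer (h <# C) = conj_set G h (coset_stabilizer C)"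
proof (rule Set.set_eqI)
  fix k
  have sub: "coset_stabilizer C \<subseteq> carrier G" unfolding coset_stabilizer_def by blast
  have "k <# (h <# C) = h <# C \<longleftrightarrow> (inv h \<otimes> k \<otimes> h) <# C = C" if k: "k \<in> carrier G"
  proof
    assume "k <# (h <# C) = h <# C"
    then have "inv h <# (k <# (h <# C)) = inv h <# (h <# C)" by simp
    then show "(inv h \<otimes> k \<otimes> h) <# C = C" using assms k by (simp add: lcos_m_assoc m_assoc lcos_mult_one)
  next
    assume "(inv h \<otimes> k \<otimes> h) <# C = C"
    then have "h <# ((inv h \<otimes> k \<otimes> h) <# C) = h <# C" by simp
    then show "k <# (h <# C) = h <# C" using assms k by (simp add: lcos_m_assoc m_assoc mult_inv_cancel)
  qed
  then show "k \<in> coset_stabilizer (h <# C) \<longleftrightarrow> k \<in> conj_set G h (coset_stabilizer C)"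
    unfolding conj_set_iff[OF sub assms(2)] unfolding coset_stabilizer_def using assms(2) by auto
qed

lemma finite_index_finite:
  assumes L: "subgroup L G" and index: "finite_index G K L" and K: "finite K" "\<one> \<in> K"
  shows "finite L"
proof -
  have "L \<subseteq> \<Union> (rcosets\<^bsub>G\<lparr>carrier := L\<rparr>\<^esub> K)"
  proof
    fix x assume x: "x \<in> L"
    then show "x \<in> \<Union> (rcosets\<^bsub>G\<lparr>carrier := L\<rparr>\<^esub> K)"
      using K(2) subgroup.mem_carrier[OF L] unfolding RCOSETS_def r_coset_def by force
  qed
  moreover have "finite C" if "C \<in> rcosets\<^bsub>G\<lparr>carrier := L\<rparr>\<^esub> K" for C
    using that K unfolding RCOSETS_def r_coset_def by auto
  ultimately show ?thesis using index unfolding finite_index_def by (meson finite_Union finite_subset)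
qed

lemma finite_index_self:
  assumes "subgroup L G" shows "finite_index G L L"
proof -
  have "rcosets\<^bsub>G\<lparr>carrier := L\<rparr>\<^esub> L \<subseteq> {L}"
  proof
    fix C assume "C \<in> rcosets\<^bsub>G\<lparr>carrier := L\<rparr>\<^esub> L"
    then obtain x where x: "x \<in> L" "C = L #> x" unfolding RCOSETS_def r_coset_def by auto
    then show "C \<in> {L}" using coset_join2[OF _ assms] subgroup.mem_carrier[OF assms] by auto
  qed
  then show ?thesis unfolding finite_index_def by (auto intro: finite_subset)
qed

end

section \<open>The correspondence between cone vertices\<close>

text \<open>
  Normality of \<open>H\<close> and invariance of the conjugates let the whole group act on the cone vertices of
  the coned-off graph of \<open>H\<close>, seen as the conjugates \<open>h Q h\<inverse>\<close>.
\<close>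

locale refined_embedding = group G for G (structure) +
  fixes H T :: "'a set" and \<Q> \<Q>' :: "'a set set"
  assumes H_normal: "H \<lhd> G"
    and finite_quotient: "finite (rcosets H)"
    and finite_collection: "finite \<Q>"
    and embedded: "hyp_embedded_wrt (G\<lparr>carrier := H\<rparr>) \<Q> T"
    and T_invariant: "g \<in> carrier G \<Longrightarrow> conj_set G g T = T"
    and conjugates_invariant: "g \<in> carrier G \<Longrightarrow>
      conj_set G g ` {conj_set G h Q | h Q. h \<in> H \<and> Q \<in> \<Q>} = {conj_set G h Q | h Q. h \<in> H \<and> Q \<in> \<Q>}"
    and refinement: "is_refinement G \<Q> \<Q>'"
begin

abbreviation GH :: "('a, 'b) monoid_scheme" where "GH \<equiv> G\<lparr>carrier := H\<rparr>"

definition conjugates :: "'a set set" where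
  "conjugates = {conj_set G h Q | h Q. h \<in> H \<and> Q \<in> \<Q>}"

lemma H_subgroup: "subgroup H G" using H_normal unfolding normal_def by blast

lemma H_subset: "H \<subseteq> carrier G" by (rule subgroup.subset[OF H_subgroup])

lemma H_carrier: "h \<in> H \<Longrightarrow> h \<in> carrier G" using H_subset by blast

sublocale H: group GH by (rule subgroup.subgroup_is_group[OF H_subgroup group_axioms])

lemma l_coset_GH: "h <#\<^bsub>GH\<^esub> C = h <# C" by (simp add: l_coset_def)

lemma conj_H:
  assumes g: "g \<in> carrier G" shows "conj_set G g H = H"
proof (rule Set.set_eqI)
  fix x
  have "x \<in> H" if "x \<in> carrier G" "inv g \<otimes> x \<otimes> g \<in> H"
    using normal.inv_op_closed2[OF H_normal g that(2)] g that(1) by (simp add: m_assoc mult_inv_cancel)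
  then show "x \<in> conj_set G g H \<longleftrightarrow> x \<in> H"
    using normal.inv_op_closed1[OF H_normal g] H_carrier unfolding conj_set_iff[OF H_subset g] by blast
qed

lemma Q_subgroup_GH: "Q \<in> \<Q> \<Longrightarrow> subgroup Q GH" and Q_infinite: "Q \<in> \<Q> \<Longrightarrow> infinite Q"
  using embedded unfolding hyp_embedded_wrt_def by auto

lemma Q_subgroup: "Q \<in> \<Q> \<Longrightarrow> subgroup Q G"
  by (rule incl_subgroup[OF H_subgroup Q_subgroup_GH])

lemma Q_subset: "Q \<in> \<Q> \<Longrightarrow> Q \<subseteq> H"
  using subgroup.subset[OF Q_subgroup_GH] by simp

lemma GH_coset_iff: "C \<in> left_cosets GH \<Q> \<longleftrightarrow> (\<exists>h\<in>H. \<exists>Q\<in>\<Q>. C = h <# Q)"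
  unfolding left_cosets_iff l_coset_GH by simp

lemma GH_coset_subset: "C \<in> left_cosets GH \<Q> \<Longrightarrow> C \<subseteq> H"
  using H.left_coset_subset[OF _ Q_subgroup_GH] by simp

lemma GH_coset_translate: "C \<in> left_cosets GH \<Q> \<Longrightarrow> h \<in> H \<Longrightarrow> h <# C \<in> left_cosets GH \<Q>"
  using H.left_coset_translate[OF _ Q_subgroup_GH, of C _ h] unfolding l_coset_GH by simp

lemma conjugates_stabilizers: "conjugates = coset_stabilizer ` left_cosets GH \<Q>"
proof -
  have "left_cosets GH \<Q> = (\<lambda>(h, Q). h <# Q) ` (H \<times> \<Q>)"
    by (auto simp: GH_coset_iff) blast
  then have "coset_stabilizer ` left_cosets GH \<Q> = (\<lambda>(h, Q). coset_stabilizer (h <# Q)) ` (H \<times> \<Q>)"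
    by (simp add: image_image case_prod_unfold)
  also have "\<dots> = (\<lambda>(h, Q). conj_set G h Q) ` (H \<times> \<Q>)"
    using coset_stabilizer_coset[OF Q_subgroup H_carrier] by (intro image_cong) auto
  also have "\<dots> = conjugates" unfolding conjugates_def by auto
  finally show ?thesis by simp
qed

lemma
  assumes "A \<in> conjugates"
  shows conjugate_subgroup: "subgroup A G" and conjugate_infinite: "infinite A"
proof -
  obtain h Q where A: "h \<in> H" "Q \<in> \<Q>" "A = conj_set G h Q"
    using assms unfolding conjugates_def by blast
  note Q = Q_subgroup[OF A(2)]
  show "subgroup A G" unfolding A(3) by (rule conj_set_subgroup[OF Q H_carrier[OF A(1)]])
  show "infinite A" unfolding A(3)
    by (rule conj_set_infinite[OF subgroup.subset[OF Q] H_carrier[OF A(1)] Q_infinite[OF A(2)]])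
qed

lemma conjugate_subset: "A \<in> conjugates \<Longrightarrow> A \<subseteq> H"
proof -
  assume "A \<in> conjugates"
  then obtain h Q where A: "h \<in> H" "Q \<in> \<Q>" "A = conj_set G h Q" unfolding conjugates_def by blast
  have "conj_set G h Q \<subseteq> conj_set G h H"
    using Q_subset[OF A(2)] unfolding conj_set_def l_coset_def r_coset_def by auto
  then show "A \<subseteq> H" using A conj_H H_carrier by simp
qed

lemma conjugate_carrier: "A \<in> conjugates \<Longrightarrow> A \<subseteq> carrier G"
  using conjugate_subset H_subset by blast

lemma conjugate_conj: "A \<in> conjugates \<Longrightarrow> g \<in> carrier G \<Longrightarrow> conj_set G g A \<in> conjugates"
  using conjugates_invariant unfolding conjugates_def by blast

lemma cone_eq_of_infinite_stabilizer:
  assumes C: "C \<in> left_cosets GH \<Q>" "C' \<in> left_cosets GH \<Q>"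
    and inf: "infinite (coset_stabilizer C \<inter> coset_stabilizer C')"
  shows "C = C'"
proof (rule H.infinite_stabilizer_unique_cone[OF embedded C])
  have "coset_stabilizer C \<in> conjugates" using C(1) conjugates_stabilizers by blast
  then have "coset_stabilizer C \<inter> coset_stabilizer C' \<subseteq>
      {k \<in> carrier GH. k <#\<^bsub>GH\<^esub> C = C \<and> k <#\<^bsub>GH\<^esub> C' = C'}"
    using conjugate_subset unfolding l_coset_GH by (auto simp: coset_stabilizer_def)
  then show "infinite {k \<in> carrier GH. k <#\<^bsub>GH\<^esub> C = C \<and> k <#\<^bsub>GH\<^esub> C' = C'}"
    using inf finite_subset by blast
qed

lemma cone_eq_of_stabilizer_eq:
  assumes "C \<in> left_cosets GH \<Q>" "C' \<in> left_cosets GH \<Q>" "coset_stabilizer C = coset_stabilizer C'"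
  shows "C = C'"
  using assms cone_eq_of_infinite_stabilizer conjugates_stabilizers conjugate_infinite
  by (metis Int_absorb imageI)

lemma conjugate_eq_of_infinite:
  assumes "A \<in> conjugates" "B \<in> conjugates" "infinite (A \<inter> B)" shows "A = B"
  using assms cone_eq_of_infinite_stabilizer unfolding conjugates_stabilizers by blast

text \<open>
  An element that commensurates \<open>A\<close> takes it to a conjugate that meets \<open>A\<close> in an infinite subgroup,
  and by almost malnormality this conjugate is \<open>A\<close>.
\<close>

lemma commensurator_conjugate:
  assumes A: "A \<in> conjugates" shows "commensurator G A = normalizer G A"
proof (rule Set.set_eqI)
  fix g
  note sub = conjugate_subgroup[OF A]
  note norm = normalizer_iff[OF conjugate_carrier[OF A]]
  show "g \<in> commensurator G A \<longleftrightarrow> g \<in> normalizer G A"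
  proof
    assume g: "g \<in> commensurator G A"
    let ?B = "conj_set G g A"
    have gG: "g \<in> carrier G" and "finite_index G (A \<inter> ?B) A" using g unfolding commensurator_def by auto
    moreover have "\<one> \<in> A \<inter> ?B"
      using subgroup.one_closed[OF sub] subgroup.one_closed[OF conj_set_subgroup[OF sub gG]] by blast
    ultimately have "infinite (A \<inter> ?B)" using finite_index_finite[OF sub] conjugate_infinite[OF A] by blast
    then have "A = ?B" by (rule conjugate_eq_of_infinite[OF A conjugate_conj[OF A gG]])
    then show "g \<in> normalizer G A" using gG norm by simp
  next
    assume "g \<in> normalizer G A"
    then show "g \<in> commensurator G A"
      using finite_index_self[OF sub] unfolding norm commensurator_def by simp
  qed
qed

lemma normalizer_subgroup: "A \<in> conjugates \<Longrightarrow> subgroup (normalizer G A) G"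
  by (rule normalizer_imp_subgroup[OF conjugate_carrier])

text \<open>
  Let \<open>A\<close> be the stabilizer of the cone vertex \<open>C\<close>. An element of \<open>H\<close> that normalizes \<open>A\<close> takes \<open>C\<close> to
  a cone vertex with the same stabilizer, hence fixes \<open>C\<close>. Thus \<open>A\<close> is recovered from its normalizer.
\<close>

lemma normalizer_Int_H:
  assumes A: "A \<in> conjugates" shows "normalizer G A \<inter> H = A"
proof
  obtain C where C: "C \<in> left_cosets GH \<Q>" "A = coset_stabilizer C"
    using A unfolding conjugates_stabilizers by blast
  note norm = normalizer_iff[OF conjugate_carrier[OF A]]
  show "normalizer G A \<inter> H \<subseteq> A"
  proof
    fix h assume "h \<in> normalizer G A \<inter> H"
    then have h: "h \<in> H" "h \<in> carrier G" "conj_set G h A = A" using norm by auto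
    have "C \<subseteq> carrier G" using GH_coset_subset[OF C(1)] H_subset by blast
    then have "coset_stabilizer (h <# C) = coset_stabilizer C"
      using coset_stabilizer_translate h(2,3) C(2) by simp
    then have "h <# C = C" by (rule cone_eq_of_stabilizer_eq[OF GH_coset_translate[OF C(1) h(1)] C(1)])
    then show "h \<in> A" using h(2) C(2) unfolding coset_stabilizer_def by simp
  qed
  show "A \<subseteq> normalizer G A \<inter> H"
  proof
    fix a assume a: "a \<in> A"
    interpret A: subgroup A G by (rule conjugate_subgroup[OF A])
    have aG: "a \<in> carrier G" using a by simp
    have "inv a \<otimes> x \<otimes> a \<in> A \<longleftrightarrow> x \<in> A" if x: "x \<in> carrier G" for x
    proof
      assume "inv a \<otimes> x \<otimes> a \<in> A"
      then have "a \<otimes> (inv a \<otimes> x \<otimes> a) \<otimes> inv a \<in> A" using a A.m_closed A.m_inv_closed by blast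
      then show "x \<in> A" using aG x by (simp add: m_assoc mult_inv_cancel)
    qed (use a A.m_closed A.m_inv_closed in blast)
    then have "conj_set G a A = A" using aG by (auto simp: conj_set_iff[OF A.subset aG])
    then show "a \<in> normalizer G A \<inter> H" using a aG norm conjugate_subset[OF A] by auto
  qed
qed

lemma Q_conjugate: "Q \<in> \<Q> \<Longrightarrow> Q \<in> conjugates"
proof -
  assume Q: "Q \<in> \<Q>"
  then have "Q = conj_set G \<one> Q" using conj_set_one[OF subgroup.subset[OF Q_subgroup]] by simp
  then show ?thesis unfolding conjugates_def using Q subgroup.one_closed[OF H_subgroup] by blast
qed

lemma commensurators_eq:
  "{commensurator G (conj_set G g Q) | g Q. g \<in> carrier G \<and> Q \<in> \<Q>} = normalizer G ` conjugates"
    (is "?L = _")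
proof
  show "?L \<subseteq> normalizer G ` conjugates"
  proof
    fix K assume "K \<in> ?L"
    then obtain g Q where K: "g \<in> carrier G" "Q \<in> \<Q>" "K = commensurator G (conj_set G g Q)" by blast
    have "conj_set G g Q \<in> conjugates" by (rule conjugate_conj[OF Q_conjugate[OF K(2)] K(1)])
    with K(3) show "K \<in> normalizer G ` conjugates" using commensurator_conjugate by simp
  qed
  show "normalizer G ` conjugates \<subseteq> ?L"
  proof (rule image_subsetI)
    fix A assume A: "A \<in> conjugates"
    then obtain h Q where "h \<in> H" "Q \<in> \<Q>" "A = conj_set G h Q" unfolding conjugates_def by blast
    then show "normalizer G A \<in> ?L" using H_carrier commensurator_conjugate[OF A] by auto
  qed
qed

lemma refined_is_normalizer: "P \<in> \<Q>' \<Longrightarrow> \<exists>A\<in>conjugates. P = normalizer G A"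
  using refinement unfolding is_refinement_def Let_def commensurators_eq by blast

lemma refined_subgroup: "P \<in> \<Q>' \<Longrightarrow> subgroup P G"
  using refined_is_normalizer normalizer_subgroup by blast

lemma refined_infinite: "P \<in> \<Q>' \<Longrightarrow> infinite P"
proof -
  assume "P \<in> \<Q>'"
  then obtain A where A: "A \<in> conjugates" "P = normalizer G A" using refined_is_normalizer by blast
  then have "A \<subseteq> P" using normalizer_Int_H by blast
  with conjugate_infinite[OF A(1)] show "infinite P" using finite_subset by blast
qed

lemma ex1_refined:
  assumes "A \<in> conjugates"
  shows "\<exists>!P. P \<in> \<Q>' \<and> (\<exists>g\<in>carrier G. normalizer G A = conj_set G g P)"
  using refinement[unfolded is_refinement_def Let_def commensurators_eq, THEN conjunct2]
    imageI[OF assms, of "normalizer G"] by (rule bspec)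

text \<open>
  Each member of the refinement represents the class of the normalizer of some \<open>Q\<close>, and this class
  has only one representative.
\<close>

lemma finite_refined: "finite \<Q>'"
proof -
  define rep where "rep Q = (THE P. P \<in> \<Q>' \<and> (\<exists>g\<in>carrier G. normalizer G Q = conj_set G g P))" for Q
  have "\<Q>' \<subseteq> rep ` \<Q>"
  proof
    fix P assume P: "P \<in> \<Q>'"
    then obtain A where A: "A \<in> conjugates" "P = normalizer G A" using refined_is_normalizer by blast
    then obtain h Q where hQ: "h \<in> H" "Q \<in> \<Q>" "A = conj_set G h Q" unfolding conjugates_def by blast
    have hG: "h \<in> carrier G" and QG: "Q \<subseteq> carrier G"
      using hQ H_carrier subgroup.subset[OF Q_subgroup] by auto
    have Q_eq: "Q = conj_set G (inv h) A" using conj_set_cancel[OF QG hG] hQ(3) by simp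
    then have Q: "Q \<in> conjugates" using conjugate_conj[OF A(1)] hG by simp
    have "normalizer G Q = conj_set G (inv h) P"
      unfolding Q_eq A(2) using normalizer_conj_set[OF conjugate_carrier[OF A(1)]] hG by simp
    then have "rep Q = P" unfolding rep_def
      using P hG by (intro the1_equality[OF ex1_refined[OF Q]]) auto
    then show "P \<in> rep ` \<Q>" using hQ(2) by blast
  qed
  then show ?thesis using finite_collection finite_surj by blast
qed

lemma refined_coset_iff: "C \<in> left_cosets G \<Q>' \<longleftrightarrow> (\<exists>g\<in>carrier G. \<exists>P\<in>\<Q>'. C = g <# P)"
  by (rule left_cosets_iff)

text \<open>
  The coset \<open>g N(A)\<close> has stabilizer \<open>N(g A g\<inverse>)\<close>, where \<open>N\<close> denotes the normalizer, and intersecting with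
  \<open>H\<close> leaves \<open>g A g\<inverse>\<close>.
\<close>

lemma coset_stabilizer_Int_H:
  assumes "C \<in> left_cosets G \<Q>'"
  obtains g A where "g \<in> carrier G" "A \<in> conjugates" "normalizer G A \<in> \<Q>'"
    "C = g <# normalizer G A" "coset_stabilizer C \<inter> H = conj_set G g A"
proof -
  obtain g P where gP: "g \<in> carrier G" "P \<in> \<Q>'" "C = g <# P"
    using assms unfolding left_cosets_iff by blast
  obtain A where A: "A \<in> conjugates" "P = normalizer G A"
    using refined_is_normalizer[OF gP(2)] by blast
  have "coset_stabilizer C = normalizer G (conj_set G g A)"
    using coset_stabilizer_coset[OF refined_subgroup[OF gP(2)] gP(1)]
      normalizer_conj_set[OF conjugate_carrier[OF A(1)] gP(1)] gP(3) A(2) by simp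
  then have "coset_stabilizer C \<inter> H = conj_set G g A"
    using normalizer_Int_H[OF conjugate_conj[OF A(1) gP(1)]] by simp
  then show thesis by (rule that[OF gP(1) A(1) gP(2)[unfolded A(2)] gP(3)[unfolded A(2)]])
qed

lemma ex1_cone:
  assumes "C \<in> left_cosets G \<Q>'"
  shows "\<exists>!D. D \<in> left_cosets GH \<Q> \<and> coset_stabilizer D = coset_stabilizer C \<inter> H"
proof -
  obtain g A where "g \<in> carrier G" "A \<in> conjugates" "coset_stabilizer C \<inter> H = conj_set G g A"
    by (rule coset_stabilizer_Int_H[OF assms])
  then have "coset_stabilizer C \<inter> H \<in> coset_stabilizer ` left_cosets GH \<Q>"
    using conjugate_conj conjugates_stabilizers by simp
  then obtain D where "D \<in> left_cosets GH \<Q>" "coset_stabilizer D = coset_stabilizer C \<inter> H"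
    by (metis imageE)
  then show ?thesis using cone_eq_of_stabilizer_eq by (intro ex1I[of _ D]) simp_all
qed

text \<open>
  The cosets of the refined subgroups and those of the original ones are matched by having the same
  stabilizer in \<open>H\<close>. The matched cosets need not intersect, and \<open>C\<close> may even be disjoint from \<open>H\<close>; the
  matching is nevertheless bijective and equivariant under \<open>H\<close>, which is all that the comparison of
  the two graphs needs.
\<close>

definition H_cone :: "'a set \<Rightarrow> 'a set" where
  "H_cone C = (THE D. D \<in> left_cosets GH \<Q> \<and> coset_stabilizer D = coset_stabilizer C \<inter> H)"

lemma H_cone:
  assumes "C \<in> left_cosets G \<Q>'"
  shows "H_cone C \<in> left_cosets GH \<Q>" "coset_stabilizer (H_cone C) = coset_stabilizer C \<inter> H"
  using theI'[OF ex1_cone[OF assms]] unfolding H_cone_def by auto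

lemma H_cone_unique:
  assumes "C \<in> left_cosets G \<Q>'" "D \<in> left_cosets GH \<Q>" "coset_stabilizer D = coset_stabilizer C \<inter> H"
  shows "H_cone C = D"
  using H_cone[OF assms(1)] assms(2,3) cone_eq_of_stabilizer_eq by simp

text \<open>
  Equal stabilizers \<open>B\<close> in \<open>H\<close> give equal normalizers, so both cosets belong to the same member of
  the refinement, namely the only one that is conjugate to the normalizer of \<open>B\<close>. The quotient of
  their representatives then normalizes \<open>A\<close>, which puts it into that member.
\<close>

lemma inj_on_H_cone: "inj_on H_cone (left_cosets G \<Q>')"
proof (rule inj_onI)
  fix C D assume C: "C \<in> left_cosets G \<Q>'" and D: "D \<in> left_cosets G \<Q>'" and eq: "H_cone C = H_cone D"
  obtain g A where A: "g \<in> carrier G" "A \<in> conjugates" "normalizer G A \<in> \<Q>'"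
    "C = g <# normalizer G A" "coset_stabilizer C \<inter> H = conj_set G g A"
    by (rule coset_stabilizer_Int_H[OF C])
  obtain k B where B: "k \<in> carrier G" "B \<in> conjugates" "normalizer G B \<in> \<Q>'"
    "D = k <# normalizer G B" "coset_stabilizer D \<inter> H = conj_set G k B"
    by (rule coset_stabilizer_Int_H[OF D])
  have same: "conj_set G g A = conj_set G k B"
    using H_cone(2)[OF C] H_cone(2)[OF D] eq A(5) B(5) by simp
  have "normalizer G (conj_set G g A) = conj_set G g (normalizer G A)"
    "normalizer G (conj_set G g A) = conj_set G k (normalizer G B)"
    unfolding normalizer_conj_set[OF conjugate_carrier[OF A(2)] A(1), symmetric]
      normalizer_conj_set[OF conjugate_carrier[OF B(2)] B(1), symmetric] same by (rule refl)+
  then have "normalizer G A = normalizer G B"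
    using ex1_refined[OF conjugate_conj[OF A(2,1)]] A(1,3) B(1,3) by blast
  then have "A = B" using normalizer_Int_H A(2) B(2) by metis
  have "conj_set G (inv g \<otimes> k) A = A"
    using same A(1) B(1) conjugate_carrier[OF A(2)] conj_set_mult[of A "inv g" k] conj_set_cancel[of A g]
    unfolding \<open>A = B\<close> by simp
  then have "inv g \<otimes> k \<in> normalizer G A"
    using normalizer_iff[OF conjugate_carrier[OF A(2)]] A(1) B(1) by simp
  then have "g \<otimes> (inv g \<otimes> k) \<in> g <# normalizer G A" by (rule l_coset_mem)
  then have "k \<in> g <# normalizer G A" using A(1) B(1) by (simp add: mult_inv_cancel)
  then show "C = D" unfolding A(4) B(4) \<open>A = B\<close>
    using l_repr_independence[OF _ A(1) normalizer_subgroup] B(2) by blast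
qed

lemma H_cone_surj:
  assumes D: "D \<in> left_cosets GH \<Q>"
  shows "\<exists>C\<in>left_cosets G \<Q>'. H_cone C = D"
proof -
  let ?A = "coset_stabilizer D"
  have A: "?A \<in> conjugates" using D conjugates_stabilizers by blast
  obtain P g where P: "P \<in> \<Q>'" "g \<in> carrier G" "normalizer G ?A = conj_set G g P"
    using ex1_refined[OF A] by blast
  have C: "g <# P \<in> left_cosets G \<Q>'" using P left_cosets_iff by blast
  moreover have "H_cone (g <# P) = D"
    by (rule H_cone_unique[OF C D])
      (use coset_stabilizer_coset[OF refined_subgroup[OF P(1)] P(2)] P(3) normalizer_Int_H[OF A] in simp)
  ultimately show ?thesis by blast
qed

lemma refined_coset_subset: "C \<in> left_cosets G \<Q>' \<Longrightarrow> C \<subseteq> carrier G"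
  by (rule left_coset_subset[OF _ refined_subgroup])

lemma H_cone_translate:
  assumes C: "C \<in> left_cosets G \<Q>'" and h: "h \<in> H"
  shows "H_cone (h <# C) = h <# H_cone C"
proof (rule H_cone_unique)
  have hG: "h \<in> carrier G" using H_carrier h .
  show "h <# C \<in> left_cosets G \<Q>'" by (rule left_coset_translate[OF C refined_subgroup hG])
  show "h <# H_cone C \<in> left_cosets GH \<Q>" by (rule GH_coset_translate[OF H_cone(1)[OF C] h])
  have sub: "coset_stabilizer C \<subseteq> carrier G" unfolding coset_stabilizer_def by blast
  have cC: "H_cone C \<subseteq> carrier G" using GH_coset_subset[OF H_cone(1)[OF C]] H_subset by blast
  show "coset_stabilizer (h <# H_cone C) = coset_stabilizer (h <# C) \<inter> H"
    unfolding coset_stabilizer_translate[OF cC hG]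
      coset_stabilizer_translate[OF refined_coset_subset[OF C] hG] H_cone(2)[OF C]
      conj_set_Int[OF sub H_subset hG] conj_H[OF hG] by (rule refl)
qed

end

section \<open>Passing from the subgroup to the group\<close>

context refined_embedding begin

text \<open>
  Since \<open>rep g\<close> is chosen from the set \<open>H g\<close>, it depends only on the coset of \<open>g\<close>, and the values form a
  finite transversal.
\<close>

definition rep :: "'a \<Rightarrow> 'a" where
  "rep g = (SOME r. r \<in> H #> g)"

definition H_part :: "'a \<Rightarrow> 'a" where
  "H_part g = g \<otimes> inv (rep g)"

lemma rep_mem: "g \<in> carrier G \<Longrightarrow> rep g \<in> H #> g"
  unfolding rep_def using rcos_self[OF _ H_subgroup] by (rule someI)

lemma rep_carrier: "g \<in> carrier G \<Longrightarrow> rep g \<in> carrier G"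
  using rep_mem r_coset_subset_G[OF H_subset] by blast

lemma finite_rep: "finite (rep ` carrier G)"
proof -
  have "rep ` carrier G = (\<lambda>C. SOME r. r \<in> C) ` (rcosets H)"
    unfolding rep_def RCOSETS_def by auto
  then show ?thesis using finite_quotient by simp
qed

lemma H_part_mem:
  assumes "g \<in> carrier G" shows "H_part g \<in> H"
proof -
  obtain h where h: "h \<in> H" "rep g = h \<otimes> g" using rep_mem[OF assms] unfolding r_coset_def by blast
  then have "H_part g = inv h" unfolding H_part_def
    using assms H_carrier[OF h(1)] by (simp add: inv_mult_group m_assoc[symmetric])
  then show ?thesis using subgroup.m_inv_closed[OF H_subgroup h(1)] by simp
qed

lemma H_part_mult_rep: "g \<in> carrier G \<Longrightarrow> H_part g \<otimes> rep g = g"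
  unfolding H_part_def using rep_carrier by (simp add: m_assoc)

lemma rep_H_mult: "h \<in> H \<Longrightarrow> g \<in> carrier G \<Longrightarrow> rep (h \<otimes> g) = rep g"
  unfolding rep_def using repr_independence[OF _ _ H_subgroup, of "h \<otimes> g" g] rcosI[of h H g] H_subset
  by simp

text \<open>
  By equivariance under \<open>H\<close> it suffices to connect, for each of the finitely many pairs of a
  representative \<open>r\<close> and a member \<open>P\<close> of the refinement, the identity with the cone vertex matched
  with \<open>r P\<close>. The same reason gives the lemma after this one, with the cosets \<open>Q\<close> in place of \<open>r P\<close>.
\<close>

lemma ex_finite_into_H_cone:
  "\<exists>E. finite E \<and> E \<subseteq> H \<and> (\<forall>C\<in>left_cosets G \<Q>'. \<forall>x\<in>C. \<exists>e\<in>E. H_part x \<otimes> e \<in> H_cone C)"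
proof -
  define e where "e r P = (SOME e. e \<in> H_cone (r <# P))" for r P
  define E where "E = (\<lambda>(r, P). e r P) ` (rep ` carrier G \<times> \<Q>')"
  have coset: "r <# P \<in> left_cosets G \<Q>'" if "r \<in> carrier G" "P \<in> \<Q>'" for r P
    using that unfolding refined_coset_iff by blast
  have ne: "D \<noteq> {}" if D: "D \<in> left_cosets GH \<Q>" for D
  proof -
    obtain h Q where "h \<in> H" "Q \<in> \<Q>" "D = h <# Q" using D GH_coset_iff by blast
    then show ?thesis using lcos_self[OF H_carrier Q_subgroup] by blast
  qed
  have e: "e r P \<in> H_cone (r <# P)" if "r \<in> carrier G" "P \<in> \<Q>'" for r P
    unfolding e_def using ne[OF H_cone(1)[OF coset[OF that]]] by (auto intro: someI)
  have "finite E" unfolding E_def using finite_rep finite_refined by simp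
  moreover have "E \<subseteq> H"
  proof -
    have "e r P \<in> H" if "r \<in> carrier G" "P \<in> \<Q>'" for r P
      using e[OF that] GH_coset_subset[OF H_cone(1)[OF coset[OF that]]] by blast
    then show ?thesis unfolding E_def using rep_carrier by auto
  qed
  moreover have "\<exists>e\<in>E. H_part x \<otimes> e \<in> H_cone C" if C: "C \<in> left_cosets G \<Q>'" and x: "x \<in> C" for C x
  proof -
    obtain g P where gP: "g \<in> carrier G" "P \<in> \<Q>'" "C = g <# P" using C unfolding refined_coset_iff by blast
    have xG: "x \<in> carrier G" using refined_coset_subset[OF C] x by blast
    have "C = x <# P"
      using l_repr_independence[OF _ gP(1) refined_subgroup[OF gP(2)]] x gP(3) by simp
    also have "\<dots> = H_part x <# (rep x <# P)"
      using lcos_m_assoc[OF subgroup.subset[OF refined_subgroup[OF gP(2)]] H_carrier[OF H_part_mem[OF xG]]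
          rep_carrier[OF xG]] H_part_mult_rep[OF xG] by simp
    finally have "H_cone C = H_part x <# H_cone (rep x <# P)"
      using H_cone_translate[OF coset[OF rep_carrier[OF xG] gP(2)] H_part_mem[OF xG]] by simp
    then have "H_part x \<otimes> e (rep x) P \<in> H_cone C"
      using l_coset_mem[OF e[OF rep_carrier[OF xG] gP(2)]] by simp
    moreover have "e (rep x) P \<in> E" unfolding E_def using xG gP(2) by auto
    ultimately show ?thesis by blast
  qed
  ultimately show ?thesis by blast
qed

lemma ex_finite_out_of_H_cone:
  "\<exists>J. finite J \<and> J \<subseteq> carrier G \<and> (\<forall>C\<in>left_cosets G \<Q>'. \<forall>x\<in>H_cone C. \<exists>j\<in>J. x \<otimes> j \<in> C)"
proof -
  have "\<exists>j. \<exists>C\<in>left_cosets G \<Q>'. H_cone C = Q \<and> j \<in> C" if Q: "Q \<in> \<Q>" for Q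
  proof -
    have "Q = \<one> <# Q" using lcos_mult_one[OF subgroup.subset[OF Q_subgroup[OF Q]]] by simp
    then have "Q \<in> left_cosets GH \<Q>" using Q subgroup.one_closed[OF H_subgroup] GH_coset_iff by blast
    then obtain C where C: "C \<in> left_cosets G \<Q>'" "H_cone C = Q" using H_cone_surj by blast
    obtain g P where gP: "g \<in> carrier G" "P \<in> \<Q>'" "C = g <# P"
      using C(1) unfolding refined_coset_iff by blast
    have "g \<in> C" unfolding gP(3) by (rule lcos_self[OF gP(1) refined_subgroup[OF gP(2)]])
    with C show ?thesis by blast
  qed
  then obtain j where j: "\<And>Q. Q \<in> \<Q> \<Longrightarrow> \<exists>C\<in>left_cosets G \<Q>'. H_cone C = Q \<and> j Q \<in> C" by metis
  have "\<exists>j'\<in>j ` \<Q>. x \<otimes> j' \<in> C" if C: "C \<in> left_cosets G \<Q>'" and x: "x \<in> H_cone C" for C x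
  proof -
    obtain h Q where hQ: "h \<in> H" "Q \<in> \<Q>" "H_cone C = h <# Q" using H_cone(1)[OF C] GH_coset_iff by blast
    have xH: "x \<in> H" using GH_coset_subset[OF H_cone(1)[OF C]] x by blast
    obtain C' where C': "C' \<in> left_cosets G \<Q>'" "H_cone C' = Q" "j Q \<in> C'" using j[OF hQ(2)] by blast
    have "H_cone (x <# C') = x <# Q" using H_cone_translate[OF C'(1) xH] C'(2) by simp
    also have "\<dots> = H_cone C"
      using l_repr_independence[OF _ H_carrier[OF hQ(1)] Q_subgroup[OF hQ(2)]] x hQ(3) by simp
    finally have "x <# C' = C"
      using inj_on_H_cone left_coset_translate[OF C'(1) refined_subgroup H_carrier[OF xH]] C
      by (auto dest: inj_onD)
    then show ?thesis using l_coset_mem[OF C'(3), of x] hQ(2) by blast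
  qed
  moreover have "j ` \<Q> \<subseteq> carrier G" using j refined_coset_subset by blast
  ultimately show ?thesis using finite_collection by blast
qed

text \<open>
  The graph \<open>\<Delta>\<close> of \<open>G\<close> is compared with the graph \<open>\<Gamma>\<close> of \<open>H\<close>, whose generating set is enlarged by a
  finite set \<open>F\<close>. One map is the inclusion of \<open>H\<close>, the other sends \<open>g = h r\<close> to \<open>h\<close>, and on cone
  vertices both are given by the matching. The set \<open>F\<close> is large enough for edges of \<open>\<Delta>\<close> to become
  walks of length at most two whose only cone vertices are images of end points of the edge. As the
  matching is injective, walks that avoid a cone vertex keep avoiding its image, so fineness of \<open>\<Gamma>\<close>
  implies fineness of \<open>\<Delta>\<close>.
\<close>

lemma refined_hyp_embedded: "hyp_embedded G \<Q>'"
proof -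
  obtain E where E: "finite E" "E \<subseteq> H"
    "\<And>C x. C \<in> left_cosets G \<Q>' \<Longrightarrow> x \<in> C \<Longrightarrow> \<exists>e\<in>E. H_part x \<otimes> e \<in> H_cone C"
    using ex_finite_into_H_cone by blast
  obtain J where J: "finite J" "J \<subseteq> carrier G"
    "\<And>C x. C \<in> left_cosets G \<Q>' \<Longrightarrow> x \<in> H_cone C \<Longrightarrow> \<exists>j\<in>J. x \<otimes> j \<in> C"
    using ex_finite_out_of_H_cone by blast
  \<comment> \<open>\<open>R\<close> moves an element to its part in \<open>H\<close>, \<open>J\<close> reaches the cone vertices of \<open>\<Delta>\<close> from \<open>H\<close>, and \<open>E\<close>
    is included so that the elements of \<open>F\<close> are products of at most three generators of \<open>\<Delta>\<close> or
    inverses of such.\<close>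
  define R where "R = rep ` carrier G"
  define S0 where "S0 = R \<union> J \<union> E"
  define F where "F = E \<union> ((\<lambda>(r, s, r'). r \<otimes> s \<otimes> inv r') ` (R \<times> S0 \<times> R) \<inter> H)"
  have RG: "R \<subseteq> carrier G" unfolding R_def using rep_carrier by blast
  have S0G: "S0 \<subseteq> carrier G" unfolding S0_def using RG J(2) E(2) H_subset by blast
  have "finite R" unfolding R_def by (rule finite_rep)
  then have "finite S0" "finite F" unfolding S0_def F_def using J(1) E(1) by simp_all
  have FH: "F \<subseteq> H" unfolding F_def using E(2) by blast
  have TH: "T \<subseteq> H" using embedded unfolding hyp_embedded_wrt_def by simp
  let ?\<Gamma> = "coned_off_Cayley_graph GH \<Q> (T \<union> F)" and ?\<Delta> = "coned_off_Cayley_graph G \<Q>' (T \<union> S0)"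
  have emb: "hyp_embedded_wrt GH \<Q> (T \<union> F)"
    by (rule H.hyp_embedded_wrt_union_finite[OF embedded \<open>finite F\<close>]) (use FH in simp)
  then have conn: "connected_graph ?\<Gamma>" and hyperb: "hyperbolic_graph ?\<Gamma>"
    and fine: "\<And>D. D \<in> left_cosets GH \<Q> \<Longrightarrow> fine_at ?\<Gamma> (Inr D)"
    unfolding H.hyp_embedded_wrt_iff by blast+
  let ?cosets = "left_cosets G \<Q>'"
  have cone_bij: "inv_into ?cosets H_cone D \<in> ?cosets" "H_cone (inv_into ?cosets H_cone D) = D"
    if "D \<in> left_cosets GH \<Q>" for D
  proof -
    have "D \<in> H_cone ` ?cosets" using H_cone_surj[OF that] by auto
    then show "inv_into ?cosets H_cone D \<in> ?cosets" "H_cone (inv_into ?cosets H_cone D) = D"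
      by (rule inv_into_into, rule f_inv_into_f)
  qed
  define f where "f = map_sum (\<lambda>h::'a. h) (inv_into ?cosets H_cone)"
  define g where "g = map_sum H_part H_cone"
  have f_vertex: "f a \<in> fst ?\<Delta>" if "a \<in> fst ?\<Gamma>" for a
    using that H_carrier cone_bij(1) by (cases a) (auto simp: f_def coned_off_vertex)
  have g_vertex: "g y \<in> fst ?\<Gamma>" if "y \<in> fst ?\<Delta>" for y
    using that H_part_mem H_cone(1) by (cases y) (auto simp: g_def coned_off_vertex)
  have \<Delta>_edge: "near ?\<Delta> 1 (Inl x) (Inl (x \<otimes> s))" if "x \<in> carrier G" "s \<in> T \<union> S0" for x s
    using that S0G TH H_subset by (intro near_edge) (auto simp: coned_off_vertex coned_off_edge)
  have f_edge: "near ?\<Delta> 3 (f a) (f b)" if e: "{a, b} \<in> snd ?\<Gamma>" for a b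
    using e
  proof (rule coned_off_edge_cases)
    fix h s assume "h \<in> carrier GH" "s \<in> T \<union> F"
    then have hH: "h \<in> H" and hG: "h \<in> carrier G" using H_carrier by auto
    have "near ?\<Delta> 3 (Inl h) (Inl (h \<otimes> s))"
    proof (cases "s \<in> T \<union> S0")
      case True
      from near_mono[OF \<Delta>_edge[OF hG True]] show ?thesis by simp
    next
      case False
      then obtain r s0 r' where s: "r \<in> R" "s0 \<in> S0" "r' \<in> R" "s = r \<otimes> s0 \<otimes> inv r'"
        using \<open>s \<in> T \<union> F\<close> unfolding F_def S0_def by auto
      have G: "r \<in> carrier G" "s0 \<in> carrier G" "r' \<in> carrier G" "s \<in> carrier G"
        using s RG S0G by auto
      have gen: "r \<in> T \<union> S0" "s0 \<in> T \<union> S0" "r' \<in> T \<union> S0" using s unfolding S0_def by auto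
      have "near ?\<Delta> 1 (Inl h) (Inl (h \<otimes> r))" "near ?\<Delta> 1 (Inl (h \<otimes> r)) (Inl (h \<otimes> r \<otimes> s0))"
        "near ?\<Delta> 1 (Inl (h \<otimes> s)) (Inl (h \<otimes> s \<otimes> r'))"
        by (intro \<Delta>_edge m_closed G hG gen)+
      moreover have "h \<otimes> s \<otimes> r' = h \<otimes> r \<otimes> s0" using G(1-3) hG s(4) by (simp add: m_assoc)
      ultimately have "near ?\<Delta> (1 + 1 + 1) (Inl h) (Inl (h \<otimes> s))" using near_trans near_sym by metis
      then show ?thesis by (simp add: numeral_3_eq_3)
    qed
    then show "near ?\<Delta> 3 (f (Inl h)) (f (Inl (h \<otimes>\<^bsub>GH\<^esub> s)))" by (simp add: f_def)
  next
    fix x D assume D: "D \<in> left_cosets GH \<Q>" and x: "x \<in> D"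
    let ?C = "inv_into ?cosets H_cone D"
    have xG: "x \<in> carrier G" using GH_coset_subset[OF D] x H_subset by blast
    obtain j where j: "j \<in> J" "x \<otimes> j \<in> ?C" using J(3)[OF cone_bij(1)[OF D]] cone_bij(2)[OF D] x by metis
    have "near ?\<Delta> 1 (Inl x) (Inl (x \<otimes> j))" by (rule \<Delta>_edge[OF xG]) (use j(1) S0_def in blast)
    moreover have "near ?\<Delta> 1 (Inl (x \<otimes> j)) (Inr ?C)"
      by (rule near_edge) (use j xG J(2) cone_bij(1)[OF D] in \<open>auto simp: coned_off_vertex coned_off_edge\<close>)
    ultimately have "near ?\<Delta> (1 + 1) (Inl x) (Inr ?C)" by (rule near_trans)
    from near_mono[OF this] show "near ?\<Delta> 3 (f (Inl x)) (f (Inr D))" by (simp add: f_def)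
  qed (rule near_sym)
  have to_cone: "\<exists>e\<in>E. H_part x \<otimes> e \<in> H_cone C \<and> {Inl (H_part x), Inl (H_part x \<otimes> e)} \<in> snd ?\<Gamma>
      \<and> H_part x \<in> H \<and> H_part x \<otimes> e \<in> H"
    if C: "C \<in> ?cosets" and x: "x \<in> C" for x C
  proof -
    obtain e where e: "e \<in> E" "H_part x \<otimes> e \<in> H_cone C" using E(3)[OF C x] by blast
    have "H_part x \<in> H" using H_part_mem refined_coset_subset[OF C] x by blast
    moreover have "H_part x \<otimes> e \<in> H" using GH_coset_subset[OF H_cone(1)[OF C]] e(2) by blast
    ultimately show ?thesis using e unfolding F_def by (intro bexI[of _ e]) (auto simp: coned_off_edge)
  qed
  \<comment> \<open>Control over the cone vertices on the walk makes the same estimate available in \<open>\<Gamma>\<close> and in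
    the complement of a cone vertex.\<close>
  define short_link where "short_link x y \<longleftrightarrow> (\<exists>p. is_walk ?\<Gamma> p \<and> hd p = x \<and> last p = y \<and> length p \<le> 3
    \<and> (\<forall>D. Inr D \<in> set p \<longrightarrow> Inr D \<in> {x, y}))" for x y
  have short_link_sym: "short_link y x" if xy: "short_link x y" for x y
  proof -
    obtain p where "is_walk ?\<Gamma> p" "hd p = x" "last p = y" "length p \<le> 3"
      "\<forall>D. Inr D \<in> set p \<longrightarrow> Inr D \<in> {x, y}" using xy unfolding short_link_def by blast
    then show ?thesis unfolding short_link_def
      by (intro exI[of _ "rev p"]) (auto simp: is_walk_rev hd_rev last_rev)
  qed
  have g_edge: "short_link (g a) (g b)" if e: "{a, b} \<in> snd ?\<Delta>" for a b
    using e
  proof (rule coned_off_edge_cases)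
    fix x s assume x: "x \<in> carrier G" and s: "s \<in> T \<union> S0"
    have sG: "s \<in> carrier G" using s S0G TH H_subset by blast
    let ?s = "rep x \<otimes> s \<otimes> inv (rep (x \<otimes> s))"
    have xs: "x \<otimes> s \<in> carrier G" using x sG by simp
    note G = x sG rep_carrier[OF x] rep_carrier[OF xs] H_carrier[OF H_part_mem[OF x]]
    \<comment> \<open>With \<open>x = h r\<close>, the product \<open>x s\<close> has \<open>H\<close>-part \<open>h (r s r'\<inverse>)\<close>, where \<open>r'\<close> represents the coset of \<open>x s\<close>.
      For \<open>s\<close> in \<open>T\<close> one has \<open>r' = r\<close>, and invariance of \<open>T\<close> applies.\<close>
    have eq: "H_part (x \<otimes> s) = H_part x \<otimes> ?s"
      using G H_part_mult_rep[OF x] unfolding H_part_def[of "x \<otimes> s"] by (simp add: m_assoc[symmetric])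
    then have "?s = inv (H_part x) \<otimes> H_part (x \<otimes> s)" using G by (simp add: mult_inv_cancel)
    then have sH: "?s \<in> H" using H_part_mem[OF x] H_part_mem[OF xs]
      using subgroup.m_closed[OF H_subgroup] subgroup.m_inv_closed[OF H_subgroup] by simp
    have "?s \<in> T \<union> F"
    proof (cases "s \<in> T")
      case True
      have "x \<otimes> s = (x \<otimes> s \<otimes> inv x) \<otimes> x" using x sG by (simp add: m_assoc)
      moreover have "x \<otimes> s \<otimes> inv x \<in> H"
        using normal.inv_op_closed2[OF H_normal x] True TH by blast
      ultimately have "rep (x \<otimes> s) = rep x" using rep_H_mult x by metis
      moreover have "rep x \<otimes> s \<otimes> inv (rep x) \<in> conj_set G (rep x) T"
        unfolding conj_set_def l_coset_def r_coset_def using True by blast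
      ultimately show ?thesis using T_invariant[OF rep_carrier[OF x]] by simp
    next
      case False
      then have "s \<in> S0" using s by blast
      then show ?thesis using sH x xs unfolding F_def R_def by force
    qed
    then have "is_walk ?\<Gamma> [Inl (H_part x), Inl (H_part (x \<otimes> s))]"
      using H_part_mem[OF x] H_part_mem[OF xs] eq by (auto simp: is_walk_def coned_off_vertex coned_off_edge)
    then show "short_link (g (Inl x)) (g (Inl (x \<otimes> s)))" unfolding short_link_def g_def
      by (intro exI[of _ "[Inl (H_part x), Inl (H_part (x \<otimes> s))]"]) auto
  next
    fix x C assume C: "C \<in> ?cosets" and x: "x \<in> C"
    obtain e where e: "H_part x \<otimes> e \<in> H_cone C" "{Inl (H_part x), Inl (H_part x \<otimes> e)} \<in> snd ?\<Gamma>"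
      "H_part x \<in> H" "H_part x \<otimes> e \<in> H" using to_cone[OF C x] by blast
    let ?p = "[Inl (H_part x), Inl (H_part x \<otimes> e), Inr (H_cone C)]"
    have "is_walk ?\<Gamma> ?p" using e H_cone(1)[OF C]
      unfolding is_walk_def by (simp add: coned_off_vertex coned_off_edge(2))
    then show "short_link (g (Inl x)) (g (Inr C))" unfolding short_link_def g_def by (intro exI[of _ ?p]) auto
  qed (rule short_link_sym)
  have g_near: "near ?\<Gamma> 3 (g a) (g b)" if ab: "{a, b} \<in> snd ?\<Delta>" for a b
  proof -
    obtain p where "is_walk ?\<Gamma> p" "hd p = g a" "last p = g b" "length p \<le> 3"
      using g_edge[OF ab] unfolding short_link_def by blast
    then show ?thesis unfolding near_def by (intro exI[of _ p]) simp
  qed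
  have fg: "near ?\<Delta> 3 y (f (g y))" if y: "y \<in> fst ?\<Delta>" for y
  proof (cases y)
    case (Inl x)
    then have x: "x \<in> carrier G" using y by (simp add: coned_off_vertex)
    have "near ?\<Delta> 1 (Inl (H_part x)) (Inl (H_part x \<otimes> rep x))"
      by (rule \<Delta>_edge[OF H_carrier[OF H_part_mem[OF x]]]) (use x S0_def R_def in blast)
    from near_mono[OF near_sym[OF this], of 3] show ?thesis
      using H_part_mult_rep[OF x] Inl by (simp add: f_def g_def)
  next
    case (Inr C)
    then have "f (g y) = y" using y inj_on_H_cone by (simp add: f_def g_def coned_off_vertex)
    then show ?thesis using near_refl[OF y] by simp
  qed
  note hyperbolic = coarse_inverse_hyperbolic[OF conn hyperb, of f ?\<Delta> g 3, OF f_vertex g_vertex f_edge g_near fg]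
  have "fine_at ?\<Delta> (Inr C)" if C: "C \<in> ?cosets" for C
    unfolding fine_at_cone[OF C refined_coset_subset[OF C]]
  proof (intro ballI allI)
    fix x n assume x: "x \<in> C"
    let ?D = "H_cone C"
    let ?\<Delta>' = "delete_vertex ?\<Delta> (Inr C)" and ?\<Gamma>' = "delete_vertex ?\<Gamma> (Inr ?D)"
    note D = H_cone(1)[OF C]
    have DH: "?D \<subseteq> carrier GH" using GH_coset_subset[OF D] by simp
    have g_D: "g a \<noteq> Inr ?D" if "a \<in> fst ?\<Delta>'" for a
      using that C inj_on_H_cone
      by (cases a) (auto simp: g_def fst_delete_vertex coned_off_vertex dest: inj_onD)
    have g_lip: "near ?\<Gamma>' (n * 2) (g a) (g b)" if "near ?\<Delta>' n a b" for a b
    proof (rule near_lipschitz[OF that])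
      show "g a \<in> fst ?\<Gamma>'" if "a \<in> fst ?\<Delta>'" for a
        using g_D[OF that] g_vertex that by (simp add: fst_delete_vertex)
      fix a b assume ab: "a \<in> fst ?\<Delta>'" "b \<in> fst ?\<Delta>'" "{a, b} \<in> snd ?\<Delta>'"
      then obtain p where p: "is_walk ?\<Gamma> p" "hd p = g a" "last p = g b" "length p \<le> 3"
        "\<And>D. Inr D \<in> set p \<Longrightarrow> Inr D \<in> {g a, g b}"
        using g_edge[of a b] unfolding short_link_def snd_delete_vertex by blast
      have "Inr ?D \<notin> set p" using p(5) g_D[OF ab(1)] g_D[OF ab(2)] by force
      then have "is_walk ?\<Gamma>' p" using p(1) by (simp add: is_walk_delete_vertex)
      then show "near ?\<Gamma>' 2 (g a) (g b)" unfolding near_def using p(2-4)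
        by (intro exI[of _ p]) simp
    qed
    have enter: "\<exists>e\<in>E. H_part y \<otimes> e \<in> ?D \<and> near ?\<Gamma>' 1 (Inl (H_part y)) (Inl (H_part y \<otimes> e))"
      if y: "y \<in> C" for y
    proof -
      obtain e where e: "e \<in> E" "H_part y \<otimes> e \<in> ?D" "{Inl (H_part y), Inl (H_part y \<otimes> e)} \<in> snd ?\<Gamma>"
        "H_part y \<in> H" "H_part y \<otimes> e \<in> H" using to_cone[OF C y] by blast
      have "near ?\<Gamma>' 1 (Inl (H_part y)) (Inl (H_part y \<otimes> e))"
        by (rule near_edge) (use e in \<open>auto simp: fst_delete_vertex snd_delete_vertex coned_off_vertex\<close>)
      then show ?thesis using e(1,2) by blast
    qed
    obtain e where e: "e \<in> E" "H_part x \<otimes> e \<in> ?D" "near ?\<Gamma>' 1 (Inl (H_part x)) (Inl (H_part x \<otimes> e))"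
      using enter[OF x] by blast
    \<comment> \<open>An element \<open>y\<close> of \<open>C\<close> is determined by the point at which its \<open>H\<close>-part enters the matched coset,
      up to the finitely many choices of the entering generator and of the representative.\<close>
    define B where "B = {b \<in> ?D. near ?\<Gamma>' (1 + n * 2 + 1) (Inl (H_part x \<otimes> e)) (Inl b)}"
    have "finite B" unfolding B_def
      using fine[OF D] e(2) unfolding fine_at_cone[OF D DH] by blast
    have "{y \<in> C. near ?\<Delta>' n (Inl x) (Inl y)} \<subseteq> (\<lambda>(b, e, r). b \<otimes> inv e \<otimes> r) ` (B \<times> E \<times> R)"
    proof (clarify)
      fix y assume y: "y \<in> C" "near ?\<Delta>' n (Inl x) (Inl y)"
      obtain e' where e': "e' \<in> E" "H_part y \<otimes> e' \<in> ?D" "near ?\<Gamma>' 1 (Inl (H_part y)) (Inl (H_part y \<otimes> e'))"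
        using enter[OF y(1)] by blast
      have "near ?\<Gamma>' (n * 2) (Inl (H_part x)) (Inl (H_part y))" using g_lip[OF y(2)] by (simp add: g_def)
      from near_trans[OF near_trans[OF near_sym[OF e(3)] this] e'(3)]
      have "H_part y \<otimes> e' \<in> B" using e'(2) unfolding B_def by simp
      moreover have yG: "y \<in> carrier G" using y(1) refined_coset_subset[OF C] by blast
      moreover have "y = (H_part y \<otimes> e') \<otimes> inv e' \<otimes> rep y"
        using H_part_mult_rep[OF yG] H_carrier[OF H_part_mem[OF yG]] e'(1) E(2) H_carrier rep_carrier[OF yG]
        by (simp add: m_assoc mult_inv_cancel subset_iff)
      ultimately show "y \<in> (\<lambda>(b, e, r). b \<otimes> inv e \<otimes> r) ` (B \<times> E \<times> R)"
        using e'(1) unfolding R_def by force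
    qed
    then show "finite {y \<in> C. near ?\<Delta>' n (Inl x) (Inl y)}"
      using \<open>finite B\<close> E(1) \<open>finite R\<close> by (meson finite_SigmaI finite_imageI finite_subset)
  qed
  then have "hyp_embedded_wrt G \<Q>' (T \<union> S0)"
    unfolding hyp_embedded_wrt_iff using hyperbolic refined_subgroup refined_infinite TH H_subset S0G by blast
  then show ?thesis unfolding hyp_embedded_def hyp_embedded_wrt_def by blast
qed

end

theorem theoremE:
  fixes G :: "('a, 'm) monoid_scheme"
    and H T :: "'a set"
    and \<Q> \<Q>' :: "'a set set"
  assumes "group G"
    and "finitely_generated G"
    and "H \<lhd> G"
    and "finite_index G H (carrier G)"
    and "T \<subseteq> H"
    and "finite \<Q>"
    and "\<And>Q. Q \<in> \<Q> \<Longrightarrow> subgroup Q (G\<lparr>carrier := H\<rparr>) \<and> infinite Q"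
    and "hyp_embedded_wrt (G\<lparr>carrier := H\<rparr>) \<Q> T"
    and "\<And>g. g \<in> carrier G \<Longrightarrow> conj_set G g T = T"
    and "\<And>g. g \<in> carrier G \<Longrightarrow>
           conj_set G g ` {conj_set G h Q | h Q. h \<in> H \<and> Q \<in> \<Q>}
             = {conj_set G h Q | h Q. h \<in> H \<and> Q \<in> \<Q>}"
    and "is_refinement G \<Q> \<Q>'"
  shows "hyp_embedded G \<Q>'"
proof -
  have "finite (rcosets\<^bsub>G\<^esub> H)"
    using assms(4) unfolding finite_index_def RCOSETS_def r_coset_def by simp
  then interpret refined_embedding G H T \<Q> \<Q>'
    using assms by (intro refined_embedding.intro refined_embedding_axioms.intro)
  show ?thesis by (rule refined_hyp_embedded)
qed

end
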